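(* Let $P$ be a finite nonempty partially ordered set. Suppose the elements of $P$ are exposed at independent times, each uniformly distributed in $[0,1]$, and that the selector assigns to the elements, as they arrive, independent weights uniformly distributed in $[0,1]$ (independent also of the arrival times). For $x\in P$ let $P_x$ be the induced partial order on the set of elements of $P$ (including $x$) that have been exposed up to the time when $x$ arrives. Consider the following strategy: reject every element that arrives up to time $1/e$, and after that accept the first arriving element $x$ that is itself the greedy maximum of $P_x$ with respect to the assigned weights (if there is no such element, nothing is accepted). Then the probability that this strategy accepts a maximal element of $P$ is at least $1/e$.
   Context: Greedy maximum: let $Q$ be a finite nonempty partially ordered set whose elements are assigned distinct real weights. Let $z_0$ be the element of smallest weight in $Q$. As long as $z_i$ is not a maximal element of $Q$, let $z_{i+1}$ be the element of minimum weight among the elements of $Q$ that are strictly larger than $z_i$ in the partial order. This gives a finite chain $z_0<z_1<\cdots$ whose terminal element is called the greedy maximum of $Q$. The random weights and arrival times are almost surely distinct, so the greedy maximum and the order of arrival are almost surely well defined. Online setting: at any given time the selector sees only the induced partial order on the elements exposed so far, and must accept or reject each element when it arrives; at most one element is accepted. The selector succeeds if the accepted element is a maximal element of $P$ (no element of $P$ is strictly larger). *)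

theory Defs
  imports "HOL-Probability.Probability"
begin

definition strictly_above :: "'a set \<Rightarrow> 'a rel \<Rightarrow> 'a \<Rightarrow> 'a set" where
  "strictly_above Q r z = {y \<in> Q. (z, y) \<in> r \<and> y \<noteq> z}"

definition maximal_in :: "'a set \<Rightarrow> 'a rel \<Rightarrow> 'a \<Rightarrow> bool" where
  "maximal_in Q r z \<longleftrightarrow> z \<in> Q \<and> strictly_above Q r z = {}"

(* The elements z_0 < z_1 < ... of the greedy chain.  If z is maximal, no element is
   strictly above it, so the step rule does not apply and the chain ends at z. *)
inductive in_greedy_chain :: "'a set \<Rightarrow> 'a rel \<Rightarrow> ('a \<Rightarrow> real) \<Rightarrow> 'a \<Rightarrow> bool"
  for Q r w where
  start: "is_arg_min w (\<lambda>z. z \<in> Q) z\<^sub>0 \<Longrightarrow> in_greedy_chain Q r w z\<^sub>0"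
| step: "in_greedy_chain Q r w z \<Longrightarrow> is_arg_min w (\<lambda>y. y \<in> strictly_above Q r z) z'
    \<Longrightarrow> in_greedy_chain Q r w z'"

definition is_greedy_maximum :: "'a set \<Rightarrow> 'a rel \<Rightarrow> ('a \<Rightarrow> real) \<Rightarrow> 'a \<Rightarrow> bool" where
  "is_greedy_maximum Q r w z \<longleftrightarrow> in_greedy_chain Q r w z \<and> maximal_in Q r z"

lemma is_arg_min_inj_unique:
  fixes w :: "'a \<Rightarrow> real"
  assumes "inj_on w Q" "S \<subseteq> Q" "is_arg_min w (\<lambda>z. z \<in> S) a" "is_arg_min w (\<lambda>z. z \<in> S) b"
  shows "a = b"
proof -
  have "a \<in> S" "b \<in> S" "\<not> w a < w b" "\<not> w b < w a"
    using assms(3,4) by (simp_all add: is_arg_min_def)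
  moreover from this have "w a = w b" by simp
  ultimately show ?thesis using assms(1,2) by (auto dest: inj_onD)
qed

(* For distinct weights the relational definition determines exactly one element. *)
lemma ex1_greedy_maximum:
  assumes fin: "finite Q" and ne: "Q \<noteq> {}" and po: "partial_order_on Q r" and inj: "inj_on w Q"
  shows "\<exists>!z. is_greedy_maximum Q r w z"
proof -
  define S where "S = {(z, z'). is_arg_min w (\<lambda>y. y \<in> strictly_above Q r z) z'}"
  have sub: "strictly_above Q r z \<subseteq> Q" for z
    by (auto simp: strictly_above_def)
  have arg_min_ex: "\<exists>z. is_arg_min w (\<lambda>y. y \<in> A) z" if "A \<subseteq> Q" "A \<noteq> {}" for A
    using ex_is_arg_min_if_finite[of A w] that fin finite_subset by blast
  have sv: "single_valued S"
    unfolding single_valued_def S_def using is_arg_min_inj_unique[OF inj sub] by blast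
  obtain z0 where z0: "is_arg_min w (\<lambda>z. z \<in> Q) z0"
    using arg_min_ex[of Q] ne by auto
  have chain_reach: "(z0, z) \<in> S\<^sup>*" if "in_greedy_chain Q r w z" for z
    using that
  proof induction
    case (start a)
    then show ?case using is_arg_min_inj_unique[OF inj subset_refl z0] by auto
  next
    case (step z z')
    then show ?case by (auto simp: S_def intro: rtrancl.rtrancl_into_rtrancl)
  qed
  have final: "z = z'" if "maximal_in Q r z" "(z, z') \<in> S\<^sup>*" for z z'
    using that(2,1) by (cases rule: converse_rtranclE) (auto simp: S_def maximal_in_def is_arg_min_def)
  have "\<exists>m. is_greedy_maximum Q r w m" if "in_greedy_chain Q r w z" for z
    using that
  proof (induction "card (strictly_above Q r z)" arbitrary: z rule: less_induct)
    case less
    have zQ: "z \<in> Q"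
      using less.prems by cases (auto simp: is_arg_min_def strictly_above_def)
    show ?case
    proof (cases "maximal_in Q r z")
      case True
      then show ?thesis using less.prems by (auto simp: is_greedy_maximum_def)
    next
      case False
      then obtain z' where z': "is_arg_min w (\<lambda>y. y \<in> strictly_above Q r z) z'"
        using arg_min_ex[OF sub, of z] zQ by (auto simp: maximal_in_def)
      then have mem: "z' \<in> strictly_above Q r z"
        by (simp add: is_arg_min_def)
      have "trans r" "antisym r"
        using po by (simp_all add: partial_order_on_def preorder_on_def)
      have "(z, z') \<in> r" "z' \<noteq> z"
        using mem by (auto simp: strictly_above_def)
      then have "strictly_above Q r z' \<subseteq> strictly_above Q r z"
        using \<open>trans r\<close> \<open>antisym r\<close>
        unfolding strictly_above_def trans_def antisym_def by blast
      moreover have "z' \<notin> strictly_above Q r z'"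
        by (simp add: strictly_above_def)
      ultimately have "strictly_above Q r z' \<subset> strictly_above Q r z"
        using mem by blast
      then have "card (strictly_above Q r z') < card (strictly_above Q r z)"
        by (rule psubset_card_mono[OF finite_subset[OF sub fin]])
      then show ?thesis
        using less.hyps in_greedy_chain.step[OF less.prems z'] by blast
    qed
  qed
  then have "\<exists>m. is_greedy_maximum Q r w m"
    using in_greedy_chain.start[OF z0] by blast
  moreover have "a = b" if "is_greedy_maximum Q r w a" "is_greedy_maximum Q r w b" for a b
  proof -
    from that have max: "maximal_in Q r a" "maximal_in Q r b"
      and reach: "(z0, a) \<in> S\<^sup>*" "(z0, b) \<in> S\<^sup>*"
      by (simp_all add: is_greedy_maximum_def chain_reach)
    from single_valued_confluent[OF sv reach] show ?thesis
      using final[OF max(1)] final[OF max(2)] by blast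
  qed
  ultimately show ?thesis by blast
qed

definition exposed :: "'a set \<Rightarrow> ('a \<Rightarrow> real) \<Rightarrow> 'a \<Rightarrow> 'a set" where
  "exposed P t x = {y \<in> P. t y \<le> t x}"

definition acceptable :: "'a set \<Rightarrow> 'a rel \<Rightarrow> ('a \<Rightarrow> real) \<Rightarrow> ('a \<Rightarrow> real) \<Rightarrow> 'a \<Rightarrow> bool" where
  "acceptable P r t w x \<longleftrightarrow> x \<in> P \<and> t x > 1 / exp 1 \<and>
     is_greedy_maximum (exposed P t x) (Restr r (exposed P t x)) w x"

(* The first acceptable element; it is unique when the arrival times are distinct. *)
definition accepts :: "'a set \<Rightarrow> 'a rel \<Rightarrow> ('a \<Rightarrow> real) \<Rightarrow> ('a \<Rightarrow> real) \<Rightarrow> 'a \<Rightarrow> bool" where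
  "accepts P r t w x \<longleftrightarrow> is_arg_min t (acceptable P r t w) x"

end

theory Submission
  imports Defs
begin

text \<open>
  Write \<open>s = 1 / e\<close>.  Two facts, one about arrival times and one about weights, are combined.

  Fix the weights.  Looking at the exposed set \<open>R\<close> backwards in time, the element that arrived last is
  uniformly distributed on \<open>R\<close> whatever came later, so it is the greedy maximum of \<open>R\<close> with probability
  exactly \<open>1 / card R\<close>, independently of the later steps.  This is the law of records in a linear order,
  hence the probability that no element exposed during \<open>(s, u)\<close> was acceptable is \<open>s / u\<close> given that
  something is exposed before \<open>u\<close>, and \<open>1\<close> otherwise.  Therefore the density at time \<open>u\<close> of accepting a
  maximal element of \<open>P\<close> is at least \<open>s / u\<^sup>2\<close> times the probability \<open>H u\<close> that the greedy maximum of
  the elements exposed by time \<open>u\<close> is maximal in \<open>P\<close>: one factor \<open>1 / u\<close> comes from the waiting argument,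
  the other from prescribing the arrival time of the greedy maximum instead of only bounding it by \<open>u\<close>.
  This is \<open>online_success_volume\<close>.

  Now let the weights vary: \<open>H u \<ge> u\<close>, which is \<open>random_subset_greedy_success\<close>.  Scale the weights of the
  exposed elements so that the pair (exposed or not, weight) becomes a single uniform label, and run
  through the labels by increasing weight.  The greedy chain is found online: the current element is
  replaced as soon as an element above it shows up.  While the current element \<open>c\<close> is not maximal in \<open>P\<close>,
  bet that the next element will be one fixed maximal element above \<open>c\<close>.  A won bet makes the greedy
  maximum maximal, and it stays so.  Since the next element is uniform among the remaining ones, some
  bet is won with probability exactly \<open>u\<close>.

  Both parts are instances of one statement about guessing the owner of the next label,
  \<open>guess_volume\<close>.  Together they bound the success probability below by the integral of
  \<open>(s / u\<^sup>2) * u = s / u\<close> over \<open>s < u < 1\<close>, which equals \<open>- s * ln s = 1 / e\<close>.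

  Volumes are taken with respect to Lebesgue measure on functions \<open>P \<Rightarrow> \<real>\<close>, so that cubes of every side
  length can be used; the passage to uniform random variables comes last.
\<close>

section \<open>Lebesgue measure on finite products of the real line\<close>

abbreviation Leb :: "'a set \<Rightarrow> ('a \<Rightarrow> real) measure" where
  "Leb I \<equiv> Pi\<^sub>M I (\<lambda>_. lborel)"

interpretation Leb: product_sigma_finite "\<lambda>_. lborel :: real measure" ..

text \<open>
  All events below are decided by the outcome of finitely many comparisons between coordinates, so they
  are finite unions of cells on which these outcomes are constant.  This gives measurability of events
  that involve the greedy chain without following its inductive definition.
\<close>

lemma sets_finitely_determined:
  fixes K :: "('b \<Rightarrow> bool) set"
  assumes "finite K" and "\<And>\<phi>. \<phi> \<in> K \<Longrightarrow> {x \<in> space N. \<phi> x} \<in> sets N"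
    and det: "\<And>x y. x \<in> space N \<Longrightarrow> y \<in> space N \<Longrightarrow> (\<And>\<phi>. \<phi> \<in> K \<Longrightarrow> \<phi> x = \<phi> y) \<Longrightarrow> p x = p y"
  shows "{x \<in> space N. p x} \<in> sets N"
proof -
  define \<J> where "\<J> = (\<lambda>x. {\<phi> \<in> K. \<phi> x}) ` {x \<in> space N. p x}"
  have "\<J> \<subseteq> Pow K" by (auto simp: \<J>_def)
  then have fin: "finite \<J>" using assms(1) finite_subset by blast
  have eq: "{x \<in> space N. p x} = (\<Union>J\<in>\<J>. {x \<in> space N. \<forall>\<phi>\<in>K. \<phi> x \<longleftrightarrow> \<phi> \<in> J})" (is "?L = ?R")
  proof
    show "?L \<subseteq> ?R" by (auto simp: \<J>_def)
    show "?R \<subseteq> ?L"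
    proof
      fix x assume "x \<in> ?R"
      then obtain y where y: "y \<in> space N" "p y" "x \<in> space N" "\<forall>\<phi>\<in>K. \<phi> x \<longleftrightarrow> \<phi> \<in> {\<phi> \<in> K. \<phi> y}"
        by (auto simp: \<J>_def)
      then have "p x = p y" by (intro det) auto
      then show "x \<in> ?L" using y by simp
    qed
  qed
  have "{x \<in> space N. \<forall>\<phi>\<in>K. \<phi> x \<longleftrightarrow> \<phi> \<in> J} \<in> sets N" for J
  proof (rule sets.sets_Collect_finite_All[OF _ assms(1)])
    show "{x \<in> space N. \<phi> x \<longleftrightarrow> \<phi> \<in> J} \<in> sets N" if "\<phi> \<in> K" for \<phi>
      using assms(2)[OF that] by (cases "\<phi> \<in> J") (auto intro: sets.sets_Collect_neg)
  qed
  then show ?thesis unfolding eq using fin by (intro sets.finite_UN) auto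
qed

lemma Leb_insert:
  assumes "finite I" "x \<notin> I" "D \<in> sets (Leb (insert x I))"
  shows "emeasure (Leb (insert x I)) D
    = (\<integral>\<^sup>+ u. emeasure (Leb I) {\<tau> \<in> space (Leb I). \<tau>(x := u) \<in> D} \<partial>lborel)"
    and "{\<tau> \<in> space (Leb I). \<tau>(x := u) \<in> D} \<in> sets (Leb I)"
proof -
  have m: "(\<lambda>\<tau>. \<tau>(x := u)) \<in> measurable (Leb I) (Leb (insert x I))" for u :: real
    by measurable
  have s: "{\<tau> \<in> space (Leb I). \<tau>(x := u) \<in> D} \<in> sets (Leb I)" for u
    using measurable_sets[OF m assms(3), of u] by (simp add: vimage_def Int_def conj_commute)
  show "{\<tau> \<in> space (Leb I). \<tau>(x := u) \<in> D} \<in> sets (Leb I)" by (rule s)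
  have "emeasure (Leb (insert x I)) D = (\<integral>\<^sup>+ \<tau>. indicator D \<tau> \<partial>Leb (insert x I))"
    using assms by simp
  also have "\<dots> = (\<integral>\<^sup>+ u. (\<integral>\<^sup>+ \<tau>. indicator D (\<tau>(x := u)) \<partial>Leb I) \<partial>lborel)"
    using assms by (intro Leb.product_nn_integral_insert_rev) auto
  also have "\<dots> = (\<integral>\<^sup>+ u. (\<integral>\<^sup>+ \<tau>. indicator {\<tau> \<in> space (Leb I). \<tau>(x := u) \<in> D} \<tau> \<partial>Leb I) \<partial>lborel)"
    by (intro nn_integral_cong) (auto simp: indicator_def)
  also have "\<dots> = (\<integral>\<^sup>+ u. emeasure (Leb I) {\<tau> \<in> space (Leb I). \<tau>(x := u) \<in> D} \<partial>lborel)"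
    using s by simp
  finally show "emeasure (Leb (insert x I)) D
    = (\<integral>\<^sup>+ u. emeasure (Leb I) {\<tau> \<in> space (Leb I). \<tau>(x := u) \<in> D} \<partial>lborel)" .
qed

text \<open>
  In the applications \<open>R\<close> consists of the elements exposed before a given moment; once \<open>R\<close> is fixed, what
  happens inside and outside \<open>R\<close> is independent.
\<close>

lemma Leb_split:
  assumes fin: "finite P" and "R \<subseteq> P" and A: "A \<in> sets (Leb R)" and B: "B \<in> sets (Leb (P - R))"
  shows "emeasure (Leb P) {\<tau> \<in> space (Leb P). restrict \<tau> R \<in> A \<and> restrict \<tau> (P - R) \<in> B}
    = emeasure (Leb R) A * emeasure (Leb (P - R)) B"
    and "{\<tau> \<in> space (Leb P). restrict \<tau> R \<in> A \<and> restrict \<tau> (P - R) \<in> B} \<in> sets (Leb P)"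
proof -
  let ?D = "{\<tau> \<in> space (Leb P). restrict \<tau> R \<in> A \<and> restrict \<tau> (P - R) \<in> B}"
  have fR: "finite R" "finite (P - R)" using fin assms(2) finite_subset by auto
  interpret R2: finite_product_sigma_finite "\<lambda>_. lborel :: real measure" "P - R"
    by standard (rule fR)
  have P: "R \<union> (P - R) = P" using assms(2) by auto
  have mR: "(\<lambda>\<tau>. restrict \<tau> R) \<in> measurable (Leb P) (Leb R)"
    and mS: "(\<lambda>\<tau>. restrict \<tau> (P - R)) \<in> measurable (Leb P) (Leb (P - R))"
    using assms(2) by (auto intro: measurable_restrict_subset)
  show D: "?D \<in> sets (Leb P)"
    using sets.Int[OF measurable_sets[OF mR A] measurable_sets[OF mS B]]
    by (rule back_subst[where P="\<lambda>X. X \<in> _"]) auto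
  have "emeasure (Leb P) ?D = emeasure (distr (Leb R \<Otimes>\<^sub>M Leb (P - R)) (Leb P) (merge R (P - R))) ?D"
    using Leb.distr_merge[of R "P - R"] fR P by simp
  also have "\<dots> = emeasure (Leb R \<Otimes>\<^sub>M Leb (P - R)) (merge R (P - R) -` ?D \<inter> space (Leb R \<Otimes>\<^sub>M Leb (P - R)))"
    using measurable_merge[of R "P - R" "\<lambda>_. lborel"] D P by (intro emeasure_distr) auto
  also have "merge R (P - R) -` ?D \<inter> space (Leb R \<Otimes>\<^sub>M Leb (P - R)) = A \<times> B" (is "?L = _")
  proof -
    have "merge R (P - R) z \<in> space (Leb P)" for z :: "('a \<Rightarrow> real) \<times> ('a \<Rightarrow> real)"
      using P by (cases z) (auto simp: space_PiM PiE_def extensional_def merge_def)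
    moreover have "z \<in> space (Leb R \<Otimes>\<^sub>M Leb (P - R)) \<Longrightarrow>
       restrict (merge R (P - R) z) R = fst z \<and> restrict (merge R (P - R) z) (P - R) = snd z" for z
      by (cases z) (auto simp: space_pair_measure space_PiM PiE_def extensional_def merge_def restrict_def fun_eq_iff)
    moreover have "z \<in> space (Leb R \<Otimes>\<^sub>M Leb (P - R))" if "z \<in> A \<times> B" for z
      using sets.sets_into_space[OF A] sets.sets_into_space[OF B] that
      by (auto simp: space_pair_measure)
    moreover have "restrict a R = a" if "a \<in> A" for a
      using sets.sets_into_space[OF A] that by (auto simp: space_PiM PiE_restrict)
    moreover have "restrict b (P - R) = b" if "b \<in> B" for b
      using sets.sets_into_space[OF B] that by (auto simp: space_PiM PiE_restrict)
    ultimately show ?thesis by (auto simp: mem_Times_iff)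
  qed
  also have "emeasure (Leb R \<Otimes>\<^sub>M Leb (P - R)) (A \<times> B) = emeasure (Leb R) A * emeasure (Leb (P - R)) B"
    by (rule R2.emeasure_pair_measure_Times[OF A B])
  finally show "emeasure (Leb P) ?D = emeasure (Leb R) A * emeasure (Leb (P - R)) B" .
qed

lemma emeasure_Leb_box:
  assumes "finite I" "a \<le> b"
  shows "emeasure (Leb I) (I \<rightarrow>\<^sub>E {a..<b}) = ennreal ((b - a) ^ card I)"
    and "I \<rightarrow>\<^sub>E {a..<b} \<in> sets (Leb I)"
proof -
  show "emeasure (Leb I) (I \<rightarrow>\<^sub>E {a..<b}) = ennreal ((b - a) ^ card I)"
    using assms by (subst Leb.emeasure_PiM) (auto simp: ennreal_power)
  show "I \<rightarrow>\<^sub>E {a..<b} \<in> sets (Leb I)"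
    using assms by (intro sets_PiM_I_finite) auto
qed

lemma sets_comparison:
  assumes "x \<in> I" "y \<in> I"
  shows "{\<tau> \<in> space (Leb I). \<tau> x < \<tau> y} \<in> sets (Leb I)"
    and "{\<tau> \<in> space (Leb I). c < \<tau> y} \<in> sets (Leb I)"
    and "{\<tau> \<in> space (Leb I). c \<le> \<tau> y} \<in> sets (Leb I)"
    and "{\<tau> \<in> space (Leb I). \<tau> x = \<tau> y} \<in> sets (Leb I)"
  using assms by measurable

lemma AE_Leb_inj_on:
  assumes fin: "finite I"
  shows "AE \<tau> in Leb I. inj_on \<tau> I"
proof -
  have tie: "AE \<tau> in Leb I. \<tau> x \<noteq> \<tau> y" if xy: "x \<in> I" "y \<in> I" "x \<noteq> y" for x y
  proof -
    \<comment> \<open>with all coordinates but \<open>x\<close> fixed, a tie confines coordinate \<open>x\<close> to one point\<close>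
    let ?D = "{\<tau> \<in> space (Leb I). \<tau> x = \<tau> y}"
    let ?J = "I - {x}"
    have I: "insert x ?J = I" using xy by auto
    have D: "?D \<in> sets (Leb I)" by (intro sets_comparison xy)
    have f: "(\<lambda>\<tau>. indicator ?D \<tau> :: ennreal) \<in> borel_measurable (Leb (insert x ?J))"
      using D I by auto
    have "emeasure (Leb I) ?D = (\<integral>\<^sup>+ \<tau>. indicator ?D \<tau> \<partial>Leb (insert x ?J))"
      using D I by simp
    also have "\<dots> = (\<integral>\<^sup>+ \<tau>. (\<integral>\<^sup>+ u. indicator ?D (\<tau>(x := u)) \<partial>lborel) \<partial>Leb ?J)"
      using fin f by (intro Leb.product_nn_integral_insert) auto
    also have "\<dots> = (\<integral>\<^sup>+ \<tau>. (\<integral>\<^sup>+ u. indicator {\<tau> y} u \<partial>lborel) \<partial>Leb ?J)"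
      using xy by (intro nn_integral_cong) (auto simp: indicator_def space_PiM PiE_def extensional_def)
    also have "\<dots> = 0" by simp
    finally have "emeasure (Leb I) ?D = 0" .
    then show ?thesis using D by (intro AE_I[where N="?D"]) auto
  qed
  have "AE \<tau> in Leb I. \<forall>x\<in>I. \<forall>y\<in>I. x \<noteq> y \<longrightarrow> \<tau> x \<noteq> \<tau> y"
    using tie fin by (intro AE_finite_allI) auto
  then show ?thesis by (auto simp: inj_on_def)
qed

lemma Leb_affine:
  assumes "finite I" "c \<noteq> 0" "f \<in> borel_measurable (Leb I)"
  shows "(\<integral>\<^sup>+ x. f x \<partial>Leb I) = ennreal (\<bar>c\<bar> ^ card I) * (\<integral>\<^sup>+ x. f (\<lambda>i\<in>I. a + c * x i) \<partial>Leb I)"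
  using assms(1,3)
proof (induction I arbitrary: f rule: finite_induct)
  case empty
  then show ?case by (simp add: PiM_empty nn_integral_count_space_finite restrict_def)
next
  case (insert i I)
  note f[measurable] = insert.prems
  have A[measurable]: "(\<lambda>x. \<lambda>j\<in>J. a + c * x j) \<in> measurable (Leb J) (Leb J)" for J :: "'a set"
    by (intro measurable_restrict) measurable
  interpret I: finite_product_sigma_finite "\<lambda>_. lborel :: real measure" I by standard (rule insert)
  define g where "g x = f (\<lambda>j\<in>insert i I. a + c * x j)" for x
  have g[measurable]: "g \<in> borel_measurable (Leb (insert i I))"
    unfolding g_def by measurable
  have g': "(\<lambda>y. \<integral>\<^sup>+ x. g (x(i := y)) \<partial>Leb I) \<in> borel_measurable lborel"
    using g by measurable
  have "(\<integral>\<^sup>+ x. f x \<partial>Leb (insert i I)) = (\<integral>\<^sup>+ y. (\<integral>\<^sup>+ x. f (x(i := y)) \<partial>Leb I) \<partial>lborel)"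
    using insert by (intro Leb.product_nn_integral_insert_rev) auto
  also have "\<dots> = \<bar>c\<bar> * (\<integral>\<^sup>+ y. (\<integral>\<^sup>+ x. f (x(i := a + c * y)) \<partial>Leb I) \<partial>lborel)"
    using assms(2) by (intro nn_integral_real_affine) measurable
  also have "\<dots> = \<bar>c\<bar> * (\<integral>\<^sup>+ y. ennreal (\<bar>c\<bar> ^ card I) * (\<integral>\<^sup>+ x. f ((\<lambda>j\<in>I. a + c * x j)(i := a + c * y)) \<partial>Leb I) \<partial>lborel)"
    by (subst insert.IH) auto
  also have "\<dots> = \<bar>c\<bar> * (\<integral>\<^sup>+ y. ennreal (\<bar>c\<bar> ^ card I) * (\<integral>\<^sup>+ x. g (x(i := y)) \<partial>Leb I) \<partial>lborel)"
    using insert.hyps(2) by (unfold g_def, intro arg_cong[where f="\<lambda>x. _ * x"] nn_integral_cong arg_cong[where f=f]) (auto simp: restrict_def)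
  also have "\<dots> = \<bar>c\<bar> * (ennreal (\<bar>c\<bar> ^ card I) * (\<integral>\<^sup>+ y. (\<integral>\<^sup>+ x. g (x(i := y)) \<partial>Leb I) \<partial>lborel))"
    by (simp only: nn_integral_cmult[OF g'])
  also have "(\<integral>\<^sup>+ y. (\<integral>\<^sup>+ x. g (x(i := y)) \<partial>Leb I) \<partial>lborel)
     = (\<integral>\<^sup>+ x. g x \<partial>Leb (insert i I))"
    using insert by (intro Leb.product_nn_integral_insert_rev[symmetric]) auto
  finally have fin: "(\<integral>\<^sup>+ x. f x \<partial>Leb (insert i I)) = \<bar>c\<bar> * (ennreal (\<bar>c\<bar> ^ card I) * (\<integral>\<^sup>+ x. g x \<partial>Leb (insert i I)))" .
  have "ennreal (\<bar>c\<bar> ^ card (insert i I)) = ennreal \<bar>c\<bar> * ennreal (\<bar>c\<bar> ^ card I)"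
    using insert.hyps by (simp add: ennreal_mult)
  then show ?case
    unfolding fin g_def by (simp only: mult.assoc)
qed

section \<open>Guessing the owner of the next label\<close>

text \<open>
  Labels are revealed in decreasing order.  Just before the label of \<open>y\<close> is revealed, the labels seen are
  those of \<open>{z \<in> Q. \<tau> y < \<tau> z}\<close>, and \<open>\<gamma>\<close> guesses whose label comes next.  The second argument of \<open>\<gamma>\<close> is the
  whole labelling; that a guess only uses labels already seen is a hypothesis of the lemmas below.
\<close>

definition no_correct_guess :: "'a set \<Rightarrow> ('a set \<Rightarrow> ('a \<Rightarrow> real) \<Rightarrow> 'a) \<Rightarrow> real \<Rightarrow> ('a \<Rightarrow> real) \<Rightarrow> bool" where
  "no_correct_guess Q \<gamma> s \<tau> \<longleftrightarrow> (\<forall>y\<in>Q. s \<le> \<tau> y \<longrightarrow> \<gamma> {z \<in> Q. \<tau> y < \<tau> z} \<tau> \<noteq> y)"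

text \<open>
  Once the largest label has been revealed, the player is in the same game on the remaining elements,
  with guesses that remember the owner \<open>y\<close> and the value \<open>u\<close> of this label.
\<close>

lemma no_correct_guess_peel:
  assumes "y \<in> Q" "\<And>z. z \<in> Q - {y} \<Longrightarrow> \<tau> z < u" "s \<le> u"
    and loc: "\<And>A \<tau> \<tau>'. (\<And>z. z \<in> A \<Longrightarrow> \<tau> z = \<tau>' z) \<Longrightarrow> \<gamma> A \<tau> = \<gamma> A \<tau>'"
  shows "no_correct_guess Q \<gamma> s (\<tau>(y := u)) \<longleftrightarrow>
    \<gamma> {} \<tau> \<noteq> y \<and> no_correct_guess (Q - {y}) (\<lambda>A \<tau>. \<gamma> (insert y A) (\<tau>(y := u))) s \<tau>"
proof -
  let ?\<tau> = "\<tau>(y := u)"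
  have e: "{z \<in> Q. ?\<tau> y < ?\<tau> z} = {}" using assms(2) by force
  have i: "{z \<in> Q. ?\<tau> x < ?\<tau> z} = insert y {z \<in> Q - {y}. \<tau> x < \<tau> z}" if "x \<in> Q - {y}" for x
    using assms(1,2) that by auto
  have g: "\<gamma> {} ?\<tau> = \<gamma> {} \<tau>" by (rule loc) auto
  have "no_correct_guess Q \<gamma> s ?\<tau> \<longleftrightarrow> (s \<le> ?\<tau> y \<longrightarrow> \<gamma> {z \<in> Q. ?\<tau> y < ?\<tau> z} ?\<tau> \<noteq> y)
     \<and> (\<forall>x\<in>Q - {y}. s \<le> ?\<tau> x \<longrightarrow> \<gamma> {z \<in> Q. ?\<tau> x < ?\<tau> z} ?\<tau> \<noteq> x)"
    using assms(1) by (auto simp only: no_correct_guess_def)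
  also have "\<dots> \<longleftrightarrow> \<gamma> {} \<tau> \<noteq> y \<and> (\<forall>x\<in>Q - {y}. s \<le> \<tau> x \<longrightarrow> \<gamma> (insert y {z \<in> Q - {y}. \<tau> x < \<tau> z}) ?\<tau> \<noteq> x)"
  proof (intro arg_cong2[where f="(\<and>)"] ball_cong refl)
    show "(s \<le> ?\<tau> y \<longrightarrow> \<gamma> {z \<in> Q. ?\<tau> y < ?\<tau> z} ?\<tau> \<noteq> y) \<longleftrightarrow> \<gamma> {} \<tau> \<noteq> y"
      unfolding e g using assms(3) by simp
    show "(s \<le> ?\<tau> x \<longrightarrow> \<gamma> {z \<in> Q. ?\<tau> x < ?\<tau> z} ?\<tau> \<noteq> x)
      \<longleftrightarrow> (s \<le> \<tau> x \<longrightarrow> \<gamma> (insert y {z \<in> Q - {y}. \<tau> x < \<tau> z}) ?\<tau> \<noteq> x)" if "x \<in> Q - {y}" for x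
      unfolding i[OF that] using that by simp
  qed
  finally show ?thesis unfolding no_correct_guess_def .
qed

lemma nn_integral_power_Ico:
  assumes "0 \<le> s" "s \<le> t"
  shows "(\<integral>\<^sup>+ u. ennreal (s * u ^ m) * indicator {s..<t} u \<partial>lborel)
    = ennreal (s * (t ^ Suc m - s ^ Suc m) / Suc m)"
proof -
  have "(\<integral>\<^sup>+ u. ennreal (s * u ^ m) * indicator {s..<t} u \<partial>lborel)
    = (\<integral>\<^sup>+ u. ennreal (s * u ^ m) * indicator {s..t} u \<partial>lborel)"
    using AE_lborel_singleton[of t] by (intro nn_integral_cong_AE) (auto simp: indicator_def)
  also have "\<dots> = ennreal (s * t ^ Suc m / Suc m - s * s ^ Suc m / Suc m)"
  proof (rule nn_integral_FTC_Icc)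
    show "((\<lambda>u. s * u ^ Suc m / Suc m) has_real_derivative s * x ^ m) (at x)" for x
      by (auto intro!: derivative_eq_intros simp del: of_nat_Suc power_Suc)
  qed (use assms in auto)
  finally show ?thesis by (simp add: diff_divide_distrib right_diff_distrib)
qed

text \<open>
  While \<open>m\<close> labels are still hidden, a guess is correct with probability \<open>1 / m\<close>, whatever has been seen.
  If \<open>k\<close> of the \<open>n\<close> labels are below \<open>s\<close>, all guesses above \<open>s\<close> fail with probability
  \<open>(n - 1) / n * \<dots> * k / (k + 1) = k / n\<close>, and \<open>k / n\<close> has mean \<open>s / t\<close>, which gives the volume
  \<open>(s / t) * t ^ n\<close>.

  The proof is an induction on the number of elements that conditions on the largest label \<open>u\<close>.  Either
  all labels are below \<open>s\<close>, or \<open>u \<ge> s\<close> belongs to one of the \<open>n - 1\<close> elements other than the first guess,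
  and the remaining labels lose the remaining game below \<open>u\<close>.  The total is
  \<open>s ^ n + (n - 1) * (\<integral>u\<in>{s..t}. s * u ^ (n - 2)) = s * t ^ (n - 1)\<close>.
\<close>

lemma guess_volume:
  assumes "finite Q" "Q \<noteq> {}" "0 \<le> s" "s \<le> t"
    and "\<And>A \<tau> \<tau>'. (\<And>z. z \<in> A \<Longrightarrow> \<tau> z = \<tau>' z) \<Longrightarrow> \<gamma> A \<tau> = \<gamma> A \<tau>'"
    and "\<And>A \<tau>. A \<subset> Q \<Longrightarrow> \<gamma> A \<tau> \<in> Q - A"
    and "{\<tau> \<in> Q \<rightarrow>\<^sub>E {0..<t}. no_correct_guess Q \<gamma> s \<tau>} \<in> sets (Leb Q)"
  shows "emeasure (Leb Q) {\<tau> \<in> Q \<rightarrow>\<^sub>E {0..<t}. no_correct_guess Q \<gamma> s \<tau>} = ennreal (s * t ^ (card Q - 1))"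
  using assms
proof (induction "card Q" arbitrary: Q \<gamma> t)
  case 0
  from 0(1) \<open>finite Q\<close> \<open>Q \<noteq> {}\<close> have False by simp
  then show ?case ..
next
  case (Suc m)
  note [simp] = \<open>finite Q\<close>
  note st = \<open>0 \<le> s\<close> \<open>s \<le> t\<close>
  note loc = Suc.prems(5) and valid = Suc.prems(6)
  define E where "E = {\<tau> \<in> Q \<rightarrow>\<^sub>E {0..<t}. no_correct_guess Q \<gamma> s \<tau>}"
  \<comment> \<open>the part of \<open>E\<close> where \<open>y\<close> owns the largest label and this label is at least \<open>s\<close>\<close>
  define E' where "E' y = {\<tau> \<in> E. s \<le> \<tau> y \<and> (\<forall>z\<in>Q - {y}. \<tau> z < \<tau> y)}" for y
  \<comment> \<open>the first guess sees no label, hence is a constant\<close>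
  define y0 where "y0 = \<gamma> {} (\<lambda>_. 0)"
  have y0: "\<gamma> {} \<tau> = y0" for \<tau> unfolding y0_def by (rule loc) auto
  have "y0 \<in> Q" unfolding y0_def using valid[of "{}"] Suc.prems(2) by auto
  have E: "E \<in> sets (Leb Q)" using Suc.prems(7) unfolding E_def .
  have E': "E' y \<in> sets (Leb Q)" if "y \<in> Q" for y
  proof -
    have "E' y = E \<inter> {\<tau> \<in> space (Leb Q). s \<le> \<tau> y \<and> (\<forall>z\<in>Q - {y}. \<tau> z < \<tau> y)}"
      using sets.sets_into_space[OF E] by (auto simp: E'_def)
    also have "\<dots> \<in> sets (Leb Q)"
      using that by (intro sets.Int E sets.sets_Collect_conj sets.sets_Collect_finite_All sets_comparison) auto
    finally show ?thesis .
  qed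
  have cube: "Q \<rightarrow>\<^sub>E {0..<s} \<in> sets (Leb Q)" "emeasure (Leb Q) (Q \<rightarrow>\<^sub>E {0..<s}) = ennreal (s ^ Suc m)"
    using emeasure_Leb_box[of Q 0 s] st Suc.hyps(2) by auto
  have vol: "emeasure (Leb Q) (E' y) = (if y = y0 then 0 else ennreal (s * (t ^ m - s ^ m) / m))"
    if y: "y \<in> Q" for y
  proof -
    let ?Q = "Q - {y}"
    have Q: "insert y ?Q = Q" using y by auto
    define \<gamma>' where "\<gamma>' u = (\<lambda>A \<tau>. \<gamma> (insert y A) (\<tau>(y := u)))" for u
    have sec: "{\<tau> \<in> space (Leb ?Q). \<tau>(y := u) \<in> E' y}
      = (if y \<noteq> y0 \<and> u \<in> {s..<t} then {\<tau> \<in> ?Q \<rightarrow>\<^sub>E {0..<u}. no_correct_guess ?Q (\<gamma>' u) s \<tau>} else {})" (is "?L = ?R") for u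
    proof -
      have "\<tau> \<in> ?L \<longleftrightarrow> \<tau> \<in> ?R" for \<tau>
      proof (cases "\<tau> \<in> ?Q \<rightarrow>\<^sub>E {0..<u} \<and> u \<in> {s..<t}")
        case True
        then have sp: "\<tau> \<in> space (Leb ?Q)" and lt: "\<And>z. z \<in> ?Q \<Longrightarrow> 0 \<le> \<tau> z \<and> \<tau> z < u" and u: "s \<le> u" "u < t"
          by (auto simp: space_PiM PiE_iff)
        have N: "no_correct_guess Q \<gamma> s (\<tau>(y := u)) \<longleftrightarrow> y \<noteq> y0 \<and> no_correct_guess ?Q (\<gamma>' u) s \<tau>"
          unfolding \<gamma>'_def y0[of \<tau>, symmetric]
          using no_correct_guess_peel[of y Q \<tau> u s \<gamma>, OF y _ u(1) loc] lt by blast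
        have "\<tau> \<in> ?Q \<rightarrow>\<^sub>E {0..<t}"
          using True u(2) PiE_mono[of ?Q "\<lambda>_. {0..<u}" "\<lambda>_. {0..<t}"] by auto
        then have "\<tau>(y := u) \<in> insert y ?Q \<rightarrow>\<^sub>E {0..<t}"
          by (rule PiE_fun_upd[rotated]) (use u st in simp)
        then have "\<tau>(y := u) \<in> Q \<rightarrow>\<^sub>E {0..<t}" unfolding Q .
        then have "\<tau>(y := u) \<in> E' y \<longleftrightarrow> no_correct_guess Q \<gamma> s (\<tau>(y := u))"
          unfolding E'_def E_def using lt u(1) by simp
        then show ?thesis using True N sp by simp
      next
        case False
        have "\<tau> \<notin> ?L"
        proof
          assume L: "\<tau> \<in> ?L"
          then have *: "\<tau>(y := u) \<in> Q \<rightarrow>\<^sub>E {0..<t}" "s \<le> u" "\<And>z. z \<in> ?Q \<Longrightarrow> \<tau> z < u"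
            by (auto simp: E'_def E_def)
          have "(\<tau>(y := u)) z \<in> {0..<t}" if "z \<in> Q" for z using *(1) that by (rule PiE_mem)
          note m = this
          have "u < t" using m[OF y] by simp
          moreover have "0 \<le> \<tau> z" if "z \<in> ?Q" for z using m[of z] that by simp
          moreover have "\<tau> \<in> extensional ?Q" using L by (auto simp: space_PiM PiE_def)
          ultimately show False using False * by (auto simp: PiE_iff)
        qed
        then show ?thesis using False by auto
      qed
      then show ?thesis by blast
    qed
    have "emeasure (Leb ?Q) {\<tau> \<in> space (Leb ?Q). \<tau>(y := u) \<in> E' y}
      = (if y = y0 then 0 else ennreal (s * u ^ (m - 1)) * indicator {s..<t} u)" for u
    proof (cases "y \<noteq> y0 \<and> u \<in> {s..<t}")
      case True
      have c: "m = card ?Q" using Suc.hyps(2) y by simp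
      have "{\<tau> \<in> ?Q \<rightarrow>\<^sub>E {0..<u}. no_correct_guess ?Q (\<gamma>' u) s \<tau>} \<in> sets (Leb ?Q)"
        using Leb_insert(2)[of ?Q y "E' y" u] E'[OF y] Q sec[of u] True by auto
      then have "emeasure (Leb ?Q) {\<tau> \<in> ?Q \<rightarrow>\<^sub>E {0..<u}. no_correct_guess ?Q (\<gamma>' u) s \<tau>} = ennreal (s * u ^ (card ?Q - 1))"
      proof (intro Suc.hyps(1)[OF c])
        show "?Q \<noteq> {}" using True \<open>y0 \<in> Q\<close> by auto
        show "\<gamma>' u A \<tau> = \<gamma>' u A \<tau>'" if "\<And>z. z \<in> A \<Longrightarrow> \<tau> z = \<tau>' z" for A \<tau> \<tau>'
          unfolding \<gamma>'_def using that by (intro loc) auto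
        show "\<gamma>' u A \<tau> \<in> ?Q - A" if "A \<subset> ?Q" for A \<tau>
          using valid[of "insert y A" "\<tau>(y := u)"] that y unfolding \<gamma>'_def by auto
      qed (use True st in auto)
      then show ?thesis using True sec c by simp
    next
      case False
      then show ?thesis using sec[of u] by auto
    qed
    then have "emeasure (Leb Q) (E' y) = (\<integral>\<^sup>+ u. (if y = y0 then 0 else ennreal (s * u ^ (m - 1)) * indicator {s..<t} u) \<partial>lborel)"
      using Leb_insert(1)[of ?Q y "E' y"] E'[OF y] Q by simp
    also have "\<dots> = (if y = y0 then 0 else ennreal (s * (t ^ m - s ^ m) / m))"
    proof (cases "y = y0")
      case False
      then have "card {y, y0} \<le> card Q" using y \<open>y0 \<in> Q\<close> by (intro card_mono) auto
      then have "m \<ge> 1" using False Suc.hyps(2) by simp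
      then show ?thesis using False nn_integral_power_Ico[OF st, of "m - 1"] by simp
    qed simp
    finally show ?thesis .
  qed
  have "emeasure (Leb Q) E = emeasure (Leb Q) ((Q \<rightarrow>\<^sub>E {0..<s}) \<union> (\<Union>y\<in>Q. E' y))"
  proof (rule emeasure_eq_AE)
    show "AE \<tau> in Leb Q. \<tau> \<in> E \<longleftrightarrow> \<tau> \<in> (Q \<rightarrow>\<^sub>E {0..<s}) \<union> (\<Union>y\<in>Q. E' y)"
      using AE_Leb_inj_on[OF Suc.prems(1)]
    proof eventually_elim
      case (elim \<tau>)
      have "\<tau> \<in> (Q \<rightarrow>\<^sub>E {0..<s}) \<union> (\<Union>y\<in>Q. E' y)" if "\<tau> \<in> E"
      proof -
        have "Max (\<tau> ` Q) \<in> \<tau> ` Q" using Suc.prems(1,2) by (intro Max_in) auto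
        then obtain y where y: "y \<in> Q" "\<tau> y = Max (\<tau> ` Q)" by auto
        then have le: "\<tau> z \<le> \<tau> y" if "z \<in> Q" for z using that by auto
        have lt: "\<tau> z < \<tau> y" if "z \<in> Q - {y}" for z
          using le[of z] elim y(1) that by (auto simp: inj_on_def less_le)
        show ?thesis
        proof (cases "s \<le> \<tau> y")
          case True
          then show ?thesis using lt \<open>\<tau> \<in> E\<close> y(1) by (auto simp: E'_def)
        next
          case False
          then have "\<tau> z < s" if "z \<in> Q" for z using le[OF that] by simp
          then show ?thesis using \<open>\<tau> \<in> E\<close> by (auto simp: E_def PiE_iff)
        qed
      qed
      moreover have "\<tau> \<in> E" if "\<tau> \<in> Q \<rightarrow>\<^sub>E {0..<s}"
      proof -
        have "\<tau> z < s \<and> 0 \<le> \<tau> z" if "z \<in> Q" for z using \<open>\<tau> \<in> Q \<rightarrow>\<^sub>E {0..<s}\<close> that by (auto simp: PiE_iff)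
        then show ?thesis using that st by (force simp: E_def PiE_iff no_correct_guess_def)
      qed
      ultimately show ?case by (auto simp: E'_def)
    qed
  next
    show "(Q \<rightarrow>\<^sub>E {0..<s}) \<union> (\<Union>y\<in>Q. E' y) \<in> sets (Leb Q)"
      using cube(1) E' by (intro sets.Un sets.finite_UN) auto
  qed (rule E)
  also have "\<dots> = emeasure (Leb Q) (Q \<rightarrow>\<^sub>E {0..<s}) + emeasure (Leb Q) (\<Union>y\<in>Q. E' y)"
  proof (rule plus_emeasure[symmetric])
    have False if "\<tau> \<in> Q \<rightarrow>\<^sub>E {0..<s}" "y \<in> Q" "\<tau> \<in> E' y" for \<tau> y
      using that by (force simp: E'_def PiE_iff)
    then show "(Q \<rightarrow>\<^sub>E {0..<s}) \<inter> (\<Union>y\<in>Q. E' y) = {}" by blast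
  qed (use E' cube in auto)
  also have "emeasure (Leb Q) (\<Union>y\<in>Q. E' y) = (\<Sum>y\<in>Q. emeasure (Leb Q) (E' y))"
  proof (rule sum_emeasure[symmetric])
    show "disjoint_family_on E' Q"
      unfolding disjoint_family_on_def
    proof (intro ballI impI)
      fix y z assume yz: "y \<in> Q" "z \<in> Q" "y \<noteq> z"
      have "\<tau> z < \<tau> y \<and> \<tau> y < \<tau> z" if "\<tau> \<in> E' y \<inter> E' z" for \<tau>
        using that yz by (simp add: E'_def)
      then show "E' y \<inter> E' z = {}" using less_asym by blast
    qed
  qed (use E' \<open>finite Q\<close> in blast)+
  also have "\<dots> = (\<Sum>y\<in>Q - {y0}. ennreal (s * (t ^ m - s ^ m) / m))"
    using vol by (intro sum.mono_neutral_cong_right) auto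
  also have "\<dots> = ennreal (m * (s * (t ^ m - s ^ m) / m))"
  proof -
    have "card (Q - {y0}) = m" using \<open>y0 \<in> Q\<close> Suc.hyps(2)[symmetric] by simp
    moreover have "0 \<le> s * (t ^ m - s ^ m) / m" using st by (simp add: power_mono)
    ultimately show ?thesis
      by (simp only: sum_constant ennreal_of_nat_eq_real_of_nat ennreal_mult'[symmetric] of_nat_0_le_iff)
  qed
  also have "m * (s * (t ^ m - s ^ m) / m) = s * (t ^ m - s ^ m)"
    by (cases "m = 0") auto
  also have "emeasure (Leb Q) (Q \<rightarrow>\<^sub>E {0..<s}) + ennreal (s * (t ^ m - s ^ m)) = ennreal (s * t ^ m)"
  proof -
    have "0 \<le> s ^ Suc m" "0 \<le> s * (t ^ m - s ^ m)" using st by (simp_all add: power_mono)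
    then show ?thesis
      unfolding cube(2) by (simp only: ennreal_plus[symmetric]) (simp add: algebra_simps)
  qed
  finally show ?case unfolding E_def using Suc.hyps(2)[symmetric] by simp
qed

section \<open>Greedy maxima\<close>

lemma in_greedy_chain_mem:
  assumes "in_greedy_chain Q r w z"
  shows "z \<in> Q"
  using assms by cases (auto simp: is_arg_min_def strictly_above_def)

text \<open>
  The greedy chain only compares weights, and each of its steps selects the lightest available element.
  Hence it is neither affected by an order preserving change of weights nor by adding elements that are
  heavier than all the old ones: such elements can only prolong the chain.
\<close>

lemma in_greedy_chain_transfer:
  assumes chain: "in_greedy_chain A r w z" and "A \<subseteq> R"
    and r: "\<And>a b. a \<in> A \<Longrightarrow> b \<in> R \<Longrightarrow> (a, b) \<in> r \<longleftrightarrow> (a, b) \<in> r'"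
    and w: "\<And>a b. a \<in> A \<Longrightarrow> b \<in> A \<Longrightarrow> w a < w b \<longleftrightarrow> w' a < w' b"
    and heavier: "\<And>a b. a \<in> A \<Longrightarrow> b \<in> R - A \<Longrightarrow> \<not> w' b < w' a"
  shows "in_greedy_chain R r' w' z"
  using chain
proof induction
  case (start z)
  have "\<not> w' b < w' z" if "b \<in> R" for b
    using start w[of b z] heavier[of z b] that by (cases "b \<in> A") (auto simp: is_arg_min_def)
  then show ?case using start \<open>A \<subseteq> R\<close>
    by (intro in_greedy_chain.start) (auto simp: is_arg_min_def)
next
  case (step z z')
  have z: "z \<in> A" using step(1) by (rule in_greedy_chain_mem)
  have z': "z' \<in> A" using step(2) by (auto simp: is_arg_min_def strictly_above_def)
  have "\<not> w' b < w' z'" if "b \<in> strictly_above R r' z" for b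
    using step(2) w[of b z'] heavier[of z' b] r[of z b] z z' that
    by (cases "b \<in> A") (auto simp: is_arg_min_def strictly_above_def)
  then show ?case
    using step(2) r[OF z] z' \<open>A \<subseteq> R\<close>
    by (intro in_greedy_chain.step[OF step(3)]) (auto simp: is_arg_min_def strictly_above_def)
qed

lemma is_greedy_maximum_cong:
  assumes "\<And>a b. a \<in> Q \<Longrightarrow> b \<in> Q \<Longrightarrow> w a < w b \<longleftrightarrow> w' a < w' b"
  shows "is_greedy_maximum Q r w z \<longleftrightarrow> is_greedy_maximum Q r w' z"
proof -
  have "in_greedy_chain Q r w' z" if "in_greedy_chain Q r w z"
    by (rule in_greedy_chain_transfer[OF that]) (use assms in auto)
  moreover have "in_greedy_chain Q r w z" if "in_greedy_chain Q r w' z"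
    by (rule in_greedy_chain_transfer[OF that]) (use assms in auto)
  ultimately show ?thesis unfolding is_greedy_maximum_def by blast
qed

lemma is_greedy_maximum_Restr:
  "is_greedy_maximum R (Restr r R) w x \<longleftrightarrow> is_greedy_maximum R r w x"
proof -
  have "in_greedy_chain R r w x" if "in_greedy_chain R (Restr r R) w x"
    by (rule in_greedy_chain_transfer[OF that]) auto
  moreover have "in_greedy_chain R (Restr r R) w x" if "in_greedy_chain R r w x"
    by (rule in_greedy_chain_transfer[OF that]) auto
  ultimately show ?thesis by (auto simp: is_greedy_maximum_def maximal_in_def strictly_above_def)
qed

lemma ex1_greedy_maximum_subset:
  assumes "partial_order_on P r" "R \<subseteq> P" "finite R" "R \<noteq> {}" "inj_on w R"
  shows "\<exists>!z. is_greedy_maximum R r w z"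
proof -
  have "partial_order_on R (Restr r R)"
  proof -
    have "refl_on R (Restr r R)" "trans (Restr r R)" "antisym (Restr r R)"
      using assms(1,2) by (auto simp: partial_order_on_def preorder_on_def
          intro!: refl_onI transI antisymI dest: refl_onD transD antisymD)
    then show ?thesis by (auto simp: partial_order_on_def preorder_on_def)
  qed
  from ex1_greedy_maximum[OF assms(3,4) this assms(5)] show ?thesis
    by (simp add: is_greedy_maximum_Restr)
qed

lemma is_greedy_maximum_mem: "is_greedy_maximum R r w z \<Longrightarrow> z \<in> R"
  by (simp add: is_greedy_maximum_def maximal_in_def)

text \<open>
  This makes a good outcome permanent: when elements are added by increasing weight, a greedy maximum
  that is maximal in \<open>P\<close> cannot be overtaken.
\<close>

lemma is_greedy_maximum_extend:
  assumes "is_greedy_maximum A r w z" "maximal_in P r z" "A \<subseteq> R" "R \<subseteq> P"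
    and "\<And>a b. a \<in> A \<Longrightarrow> b \<in> R - A \<Longrightarrow> \<not> w b < w a"
  shows "is_greedy_maximum R r w z"
proof -
  have "in_greedy_chain R r w z"
    by (rule in_greedy_chain_transfer[of A r w]) (use assms in \<open>auto simp: is_greedy_maximum_def\<close>)
  moreover have "maximal_in R r z"
    using assms(2-4) is_greedy_maximum_mem[OF assms(1)] by (auto simp: maximal_in_def strictly_above_def)
  ultimately show ?thesis by (simp add: is_greedy_maximum_def)
qed

text \<open>
  By maximality of \<open>c\<close> in \<open>A\<close>, the new heaviest element is the only continuation of the chain after \<open>c\<close>.
\<close>

lemma is_greedy_maximum_insert:
  assumes "trans r" "antisym r"
    and c: "is_greedy_maximum A r w c" and "(c, b) \<in> r" "b \<notin> A"
    and heavier: "\<And>a. a \<in> A \<Longrightarrow> \<not> w b < w a"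
  shows "is_greedy_maximum (insert b A) r w b"
proof -
  have above_c: "y = c" if "y \<in> A" "(c, y) \<in> r" for y
    using c that by (auto simp: is_greedy_maximum_def maximal_in_def strictly_above_def)
  have cA: "c \<in> A" using c by (rule is_greedy_maximum_mem)
  have "in_greedy_chain (insert b A) r w c"
    by (rule in_greedy_chain_transfer[of A r w]) (use c heavier in \<open>auto simp: is_greedy_maximum_def\<close>)
  moreover have "strictly_above (insert b A) r c = {b}"
    using above_c cA assms(4,5) by (auto simp: strictly_above_def)
  ultimately have "in_greedy_chain (insert b A) r w b"
    by - (rule in_greedy_chain.step[of _ _ _ c], auto simp: is_arg_min_def)
  moreover have "strictly_above (insert b A) r b = {}"
    using assms(1,2,4,5) above_c cA unfolding strictly_above_def trans_def antisym_def by blast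
  ultimately show ?thesis by (simp add: is_greedy_maximum_def maximal_in_def)
qed

lemma is_greedy_maximum_singleton: "is_greedy_maximum {b} r w b"
  unfolding is_greedy_maximum_def
  by (auto intro!: in_greedy_chain.start simp: is_arg_min_def maximal_in_def strictly_above_def)

lemma ex_maximal_above:
  assumes fin: "finite P" and po: "partial_order_on P r" and "c \<in> P"
  shows "\<exists>z. maximal_in P r z \<and> (c, z) \<in> r"
  using \<open>c \<in> P\<close>
proof (induction "card (strictly_above P r c)" arbitrary: c rule: less_induct)
  case less
  have r: "refl_on P r" "trans r" "antisym r"
    using po by (auto simp: partial_order_on_def preorder_on_def)
  show ?case
  proof (cases "maximal_in P r c")
    case True
    then show ?thesis using r less.prems by (auto simp: refl_on_def)
  next
    case False
    then obtain d where d: "d \<in> P" "(c, d) \<in> r" "d \<noteq> c"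
      using less.prems by (auto simp: maximal_in_def strictly_above_def)
    then have "strictly_above P r d \<subset> strictly_above P r c"
      using r unfolding strictly_above_def trans_def antisym_def by blast
    then have "card (strictly_above P r d) < card (strictly_above P r c)"
      by (intro psubset_card_mono) (auto simp: strictly_above_def fin)
    from less.hyps[OF this d(1)] show ?thesis using d r(2) by (auto dest: transD)
  qed
qed

text \<open>
  The bet placed when \<open>A\<close> are the elements seen so far, by increasing weight.  A good bet is a maximal
  element of \<open>P\<close> above the current greedy maximum of \<open>A\<close>, or any maximal element of \<open>P\<close> if \<open>A\<close> is empty.
  If the greedy maximum is already maximal in \<open>P\<close>, there is nothing left to win and any unseen element
  will do; for distinct weights this is the only situation without a good bet.
\<close>

definition greedy_guess :: "'a set \<Rightarrow> 'a rel \<Rightarrow> 'a set \<Rightarrow> ('a \<Rightarrow> real) \<Rightarrow> 'a" where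
  "greedy_guess P r A w =
    (let good = (\<lambda>z. z \<in> P - A \<and> maximal_in P r z \<and> (\<forall>c. is_greedy_maximum A r w c \<longrightarrow> (c, z) \<in> r))
     in if \<exists>z. good z then SOME z. good z else SOME z. z \<in> P - A)"

lemma greedy_guess_valid:
  assumes "A \<subset> P"
  shows "greedy_guess P r A w \<in> P - A"
proof -
  have "\<exists>z. z \<in> P - A" using assms by auto
  then have "(SOME z. z \<in> P - A) \<in> P - A" by (rule someI_ex)
  moreover have "(SOME z. good z) \<in> P - A" if "\<exists>z. good z" "\<And>z. good z \<Longrightarrow> z \<in> P - A" for good
    using someI_ex[OF that(1)] that(2) by blast
  ultimately show ?thesis unfolding greedy_guess_def Let_def by (smt (verit))
qed

lemma greedy_guess_cong:
  assumes "\<And>a b. a \<in> A \<Longrightarrow> b \<in> A \<Longrightarrow> w a < w b \<longleftrightarrow> w' a < w' b"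
  shows "greedy_guess P r A w = greedy_guess P r A w'"
  unfolding greedy_guess_def using is_greedy_maximum_cong[of A w w' r] assms by simp

text \<open>
  If the won bet \<open>y\<close> was a good one, then \<open>y\<close> becomes the greedy maximum at this moment; otherwise the
  greedy maximum was maximal in \<open>P\<close> before.  In both cases it remains the greedy maximum when the heavier
  elements of \<open>R\<close> are added.
\<close>

lemma greedy_guess_correct:
  assumes fin: "finite P" and po: "partial_order_on P r" and "R \<subseteq> P" and inj: "inj_on w R" and y: "y \<in> R"
    and guess: "greedy_guess P r {z \<in> R. w z < w y} w = y"
  shows "\<exists>b. is_greedy_maximum R r w b \<and> maximal_in P r b"
proof -
  define A where "A = {z \<in> R. w z < w y}"
  have A: "A \<subseteq> R" "y \<notin> A" "A \<subseteq> P" using \<open>R \<subseteq> P\<close> by (auto simp: A_def)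
  have fA: "finite A" using fin A(3) finite_subset by blast
  have r: "trans r" "antisym r"
    using po by (auto simp: partial_order_on_def preorder_on_def)
  define good where
    "good = (\<lambda>z. z \<in> P - A \<and> maximal_in P r z \<and> (\<forall>c. is_greedy_maximum A r w c \<longrightarrow> (c, z) \<in> r))"
  have g: "y = (if \<exists>z. good z then SOME z. good z else SOME z. z \<in> P - A)"
    using guess unfolding A_def[symmetric] greedy_guess_def Let_def good_def[symmetric] by simp
  have ex1: "A \<noteq> {} \<Longrightarrow> \<exists>!c. is_greedy_maximum A r w c"
    using A(1) inj by (intro ex1_greedy_maximum_subset[OF po A(3) fA]) (auto intro: inj_on_subset)
  show ?thesis
  proof (cases "\<exists>z. good z")
    case True
    then have "good y" using g someI_ex[of good] by simp
    then have y': "maximal_in P r y" "\<And>c. is_greedy_maximum A r w c \<Longrightarrow> (c, y) \<in> r"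
      by (auto simp: good_def)
    have "is_greedy_maximum (insert y A) r w y"
    proof (cases "A = {}")
      case True
      then show ?thesis by (simp add: is_greedy_maximum_singleton)
    next
      case False
      then obtain c where "is_greedy_maximum A r w c" using ex1 by blast
      then show ?thesis
        using y' A by (intro is_greedy_maximum_insert[OF r]) (auto simp: A_def)
    qed
    then have "is_greedy_maximum R r w y"
      using y'(1) A y \<open>R \<subseteq> P\<close> by - (rule is_greedy_maximum_extend[of "insert y A" r w y P R], auto simp: A_def)
    then show ?thesis using y'(1) by blast
  next
    case False
    have "A \<noteq> {}"
    proof
      assume "A = {}"
      obtain z where "maximal_in P r z" using ex_maximal_above[OF fin po] y \<open>R \<subseteq> P\<close> by blast
      moreover have "\<not> is_greedy_maximum {} r w c" for c using is_greedy_maximum_mem[of "{}" r w c] by blast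
      ultimately have "good z" using \<open>A = {}\<close> by (simp add: good_def maximal_in_def)
      then show False using False by blast
    qed
    then obtain c where c: "is_greedy_maximum A r w c" and uniq: "\<And>c'. is_greedy_maximum A r w c' \<Longrightarrow> c' = c"
      using ex1 by blast
    have cA: "c \<in> A" using c by (rule is_greedy_maximum_mem)
    then obtain z where z: "maximal_in P r z" "(c, z) \<in> r"
      using ex_maximal_above[OF fin po, of c] A by blast
    have "z = c"
    proof (rule ccontr)
      assume "z \<noteq> c"
      then have "z \<notin> A" using c z by (auto simp: is_greedy_maximum_def maximal_in_def strictly_above_def)
      then have "good z" using z uniq by (auto simp: good_def maximal_in_def)
      then show False using False by blast
    qed
    then have "is_greedy_maximum R r w c"
      using z c A y \<open>R \<subseteq> P\<close> by - (rule is_greedy_maximum_extend[of A r w c P R], auto simp: A_def)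
    then show ?thesis using z \<open>z = c\<close> by blast
  qed
qed

section \<open>The greedy maximum of a random subset\<close>

lemma sets_order_determined:
  assumes "finite I"
    and det: "\<And>\<tau> \<tau>'. (\<And>x y. x \<in> I \<Longrightarrow> y \<in> I \<Longrightarrow> \<tau> x < \<tau> y \<longleftrightarrow> \<tau>' x < \<tau>' y) \<Longrightarrow>
      (\<And>x. x \<in> I \<Longrightarrow> s \<le> \<tau> x \<longleftrightarrow> s \<le> \<tau>' x) \<Longrightarrow> p \<tau> = p \<tau>'"
  shows "{\<tau> \<in> space (Leb I). p \<tau>} \<in> sets (Leb I)"
proof (rule sets_finitely_determined)
  let ?K = "(\<lambda>(x, y) \<tau>. \<tau> x < \<tau> y) ` (I \<times> I) \<union> (\<lambda>x \<tau>. s \<le> \<tau> x) ` I"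
  show "finite ?K" using assms(1) by blast
  show "{\<tau> \<in> space (Leb I). \<phi> \<tau>} \<in> sets (Leb I)" if "\<phi> \<in> ?K" for \<phi>
    using that by (auto intro!: sets_comparison)
  fix \<tau> \<tau>' assume *: "\<And>\<phi>. \<phi> \<in> ?K \<Longrightarrow> \<phi> \<tau> = \<phi> \<tau>'"
  show "p \<tau> = p \<tau>'"
  proof (rule det)
    show "\<tau> x < \<tau> y \<longleftrightarrow> \<tau>' x < \<tau>' y" if "x \<in> I" "y \<in> I" for x y
      by (rule *[of "\<lambda>\<tau>. \<tau> x < \<tau> y"]) (use that in force)
    show "s \<le> \<tau> x \<longleftrightarrow> s \<le> \<tau>' x" if "x \<in> I" for x
      by (rule *[of "\<lambda>\<tau>. s \<le> \<tau> x"]) (use that in force)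
  qed
qed

text \<open>
  Both guessing strategies used here look at labels only through their order, which makes the event of
  never guessing correctly measurable.
\<close>

lemma order_guess_volume:
  assumes Q: "finite Q" "Q \<noteq> {}" "0 \<le> s" "s \<le> t"
    and cong: "\<And>A \<tau> \<tau>'. (\<And>a b. a \<in> A \<Longrightarrow> b \<in> A \<Longrightarrow> \<tau> a < \<tau> b \<longleftrightarrow> \<tau>' a < \<tau>' b) \<Longrightarrow> \<gamma> A \<tau> = \<gamma> A \<tau>'"
    and valid: "\<And>A \<tau>. A \<subset> Q \<Longrightarrow> \<gamma> A \<tau> \<in> Q - A"
  shows "{\<tau> \<in> Q \<rightarrow>\<^sub>E {0..<t}. no_correct_guess Q \<gamma> s \<tau>} \<in> sets (Leb Q)"
    and "emeasure (Leb Q) {\<tau> \<in> Q \<rightarrow>\<^sub>E {0..<t}. no_correct_guess Q \<gamma> s \<tau>} = ennreal (s * t ^ (card Q - 1))"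
proof -
  have "{\<tau> \<in> space (Leb Q). no_correct_guess Q \<gamma> s \<tau>} \<in> sets (Leb Q)"
  proof (rule sets_order_determined[OF Q(1)])
    fix \<tau> \<tau>' :: "'a \<Rightarrow> real"
    assume *: "\<And>x y. x \<in> Q \<Longrightarrow> y \<in> Q \<Longrightarrow> \<tau> x < \<tau> y \<longleftrightarrow> \<tau>' x < \<tau>' y" "\<And>x. x \<in> Q \<Longrightarrow> s \<le> \<tau> x \<longleftrightarrow> s \<le> \<tau>' x"
    show "no_correct_guess Q \<gamma> s \<tau> = no_correct_guess Q \<gamma> s \<tau>'"
      unfolding no_correct_guess_def
    proof (rule ball_cong[OF refl])
      fix y assume y: "y \<in> Q"
      then have "{z \<in> Q. \<tau> y < \<tau> z} = {z \<in> Q. \<tau>' y < \<tau>' z}" using *(1) by blast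
      moreover have "\<gamma> {z \<in> Q. \<tau> y < \<tau> z} \<tau> = \<gamma> {z \<in> Q. \<tau> y < \<tau> z} \<tau>'"
        by (rule cong) (simp add: *(1))
      ultimately show "(s \<le> \<tau> y \<longrightarrow> \<gamma> {z \<in> Q. \<tau> y < \<tau> z} \<tau> \<noteq> y)
        \<longleftrightarrow> (s \<le> \<tau>' y \<longrightarrow> \<gamma> {z \<in> Q. \<tau>' y < \<tau>' z} \<tau>' \<noteq> y)"
        using *(2)[OF y] by simp
    qed
  qed
  moreover have "{\<tau> \<in> Q \<rightarrow>\<^sub>E {0..<t}. no_correct_guess Q \<gamma> s \<tau>}
     = (Q \<rightarrow>\<^sub>E {0..<t}) \<inter> {\<tau> \<in> space (Leb Q). no_correct_guess Q \<gamma> s \<tau>}"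
    by (auto simp: space_PiM)
  ultimately show m: "{\<tau> \<in> Q \<rightarrow>\<^sub>E {0..<t}. no_correct_guess Q \<gamma> s \<tau>} \<in> sets (Leb Q)"
    using emeasure_Leb_box(2)[OF Q(1), of 0 t] Q by auto
  show "emeasure (Leb Q) {\<tau> \<in> Q \<rightarrow>\<^sub>E {0..<t}. no_correct_guess Q \<gamma> s \<tau>} = ennreal (s * t ^ (card Q - 1))"
    by (rule guess_volume[OF Q _ valid m]) (rule cong, simp)
qed

definition greedy_success :: "'a set \<Rightarrow> 'a rel \<Rightarrow> 'a set \<Rightarrow> ('a \<Rightarrow> real) \<Rightarrow> bool" where
  "greedy_success P r R w \<longleftrightarrow> (\<exists>b. is_greedy_maximum R r w b \<and> maximal_in P r b)"

lemma greedy_success_cong: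
  assumes "\<And>a b. a \<in> R \<Longrightarrow> b \<in> R \<Longrightarrow> w a < w b \<longleftrightarrow> w' a < w' b"
  shows "greedy_success P r R w \<longleftrightarrow> greedy_success P r R w'"
  unfolding greedy_success_def using is_greedy_maximum_cong[of R w w' r] assms by simp

lemma sets_greedy_success:
  assumes "finite I" "R \<subseteq> I" "B \<in> sets borel"
  shows "{w \<in> I \<rightarrow>\<^sub>E B. greedy_success P r R w} \<in> sets (Leb I)"
    and "{w \<in> I \<rightarrow>\<^sub>E B. greedy_success P r R (\<lambda>x. - w x)} \<in> sets (Leb I)"
proof -
  have B: "I \<rightarrow>\<^sub>E B \<in> sets (Leb I)" using assms by (intro sets_PiM_I_finite) auto
  have "{w \<in> space (Leb I). greedy_success P r R w} \<in> sets (Leb I)"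
    by (rule sets_order_determined[OF assms(1)], rule greedy_success_cong) (use assms(2) in auto)
  moreover have "{w \<in> space (Leb I). greedy_success P r R (\<lambda>x. - w x)} \<in> sets (Leb I)"
    by (rule sets_order_determined[OF assms(1)], rule greedy_success_cong) (use assms(2) in auto)
  moreover have "{w \<in> I \<rightarrow>\<^sub>E B. p w} = (I \<rightarrow>\<^sub>E B) \<inter> {w \<in> space (Leb I). p w}" for p
    by (auto simp: space_PiM)
  ultimately show "{w \<in> I \<rightarrow>\<^sub>E B. greedy_success P r R w} \<in> sets (Leb I)"
    "{w \<in> I \<rightarrow>\<^sub>E B. greedy_success P r R (\<lambda>x. - w x)} \<in> sets (Leb I)"
    using B by auto
qed

text \<open>
  The map \<open>w \<mapsto> 1 - t * w\<close> turns the weights of \<open>R\<close> into labels in \<open>[1 - t, 1)\<close>.  It reverses the order, so that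
  revealing labels in decreasing order means going through \<open>R\<close> by increasing weight.
\<close>

lemma greedy_success_rescale:
  assumes "finite R" "0 < t"
  shows "emeasure (Leb R) {l \<in> R \<rightarrow>\<^sub>E {1 - t..<1}. greedy_success P r R (\<lambda>x. - l x)}
    = ennreal (t ^ card R) * emeasure (Leb R) {w \<in> R \<rightarrow>\<^sub>E {0<..1}. greedy_success P r R w}"
proof -
  let ?L = "{l \<in> R \<rightarrow>\<^sub>E {1 - t..<1}. greedy_success P r R (\<lambda>x. - l x)}"
  let ?W = "{w \<in> R \<rightarrow>\<^sub>E {0<..1}. greedy_success P r R w}"
  have L: "?L \<in> sets (Leb R)" and W: "?W \<in> sets (Leb R)"
    using assms(1) by (intro sets_greedy_success; simp)+
  have "emeasure (Leb R) ?L = (\<integral>\<^sup>+ l. indicator ?L l \<partial>Leb R)"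
    using L by simp
  also have "\<dots> = ennreal (\<bar>- t\<bar> ^ card R) * (\<integral>\<^sup>+ w. indicator ?L (\<lambda>i\<in>R. 1 + - t * w i) \<partial>Leb R)"
    using assms L by (intro Leb_affine) auto
  also have "(\<integral>\<^sup>+ w. indicator ?L (\<lambda>i\<in>R. 1 + - t * w i) \<partial>Leb R) = (\<integral>\<^sup>+ w. indicator ?W w \<partial>Leb R)"
  proof (rule nn_integral_cong)
    fix w :: "'a \<Rightarrow> real" assume "w \<in> space (Leb R)"
    then have "w \<in> extensional R" by (auto simp: space_PiM PiE_def)
    moreover have "greedy_success P r R (\<lambda>x. - (\<lambda>i\<in>R. 1 + - t * w i) x) \<longleftrightarrow> greedy_success P r R w"
      using assms(2) by (intro greedy_success_cong) simp
    moreover have "(\<lambda>i\<in>R. 1 + - t * w i) \<in> R \<rightarrow>\<^sub>E {1 - t..<1} \<longleftrightarrow> (\<forall>i\<in>R. w i \<in> {0<..1})"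
      using assms(2) by (auto simp: PiE_iff zero_less_mult_iff)
    ultimately have "(\<lambda>i\<in>R. 1 + - t * w i) \<in> ?L \<longleftrightarrow> w \<in> ?W"
      by (simp add: PiE_iff)
    then show "indicator ?L (\<lambda>i\<in>R. 1 + - t * w i) = (indicator ?W w :: ennreal)"
      by (simp add: indicator_def)
  qed
  also have "\<dots> = emeasure (Leb R) ?W" using W by simp
  finally show ?thesis using assms(2) by simp
qed

text \<open>
  The right-hand side is the probability that, in a random subset containing each element independently
  with probability \<open>t\<close>, the greedy maximum for random weights is maximal in \<open>P\<close>.  Give each element of \<open>P\<close> a
  uniform label in \<open>[0, 1)\<close>, put it into the subset if the label is at least \<open>1 - t\<close>, and use the labels as
  reversed weights.  Placing the bets \<open>greedy_guess\<close>, all bets on labels at least \<open>1 - t\<close> are lost with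
  probability \<open>1 - t\<close>, and one won bet suffices.
\<close>

lemma random_subset_greedy_success:
  assumes fin: "finite P" and "P \<noteq> {}" and po: "partial_order_on P r" and t: "0 < t" "t \<le> 1"
  shows "ennreal t \<le> (\<Sum>R\<in>Pow P. ennreal (t ^ card R * (1 - t) ^ card (P - R)) *
    emeasure (Leb P) {w \<in> P \<rightarrow>\<^sub>E {0..1}. greedy_success P r R w})"
proof -
  define \<gamma> where "\<gamma> A l = greedy_guess P r A (\<lambda>x. - l x)" for A l
  define N where "N = {l \<in> P \<rightarrow>\<^sub>E {0..<1}. no_correct_guess P \<gamma> (1 - t) l}"
  define C where "C = P \<rightarrow>\<^sub>E {0..<1::real}"
  define L where "L R = {l \<in> R \<rightarrow>\<^sub>E {1 - t..<1}. greedy_success P r R (\<lambda>x. - l x)}" for R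
  define B where "B R = (P - R) \<rightarrow>\<^sub>E {0..<1 - t}" for R
  \<comment> \<open>the event that the random subset is \<open>R\<close> and that its greedy maximum is maximal in \<open>P\<close>\<close>
  define D where "D R = {l \<in> space (Leb P). restrict l R \<in> L R \<and> restrict l (P - R) \<in> B R}" for R
  have fR: "finite R" "finite (P - R)" if "R \<subseteq> P" for R using fin that finite_subset by auto
  have N: "N \<in> sets (Leb P)" "emeasure (Leb P) N = ennreal (1 - t)"
  proof -
    have cong: "\<gamma> A \<tau> = \<gamma> A \<tau>'" if "\<And>a b. a \<in> A \<Longrightarrow> b \<in> A \<Longrightarrow> \<tau> a < \<tau> b \<longleftrightarrow> \<tau>' a < \<tau>' b" for A \<tau> \<tau>'
      unfolding \<gamma>_def by (rule greedy_guess_cong) (simp add: that)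
    have valid: "\<gamma> A \<tau> \<in> P - A" if "A \<subset> P" for A \<tau>
      unfolding \<gamma>_def using that by (rule greedy_guess_valid)
    show "N \<in> sets (Leb P)" "emeasure (Leb P) N = ennreal (1 - t)"
      using order_guess_volume[OF fin \<open>P \<noteq> {}\<close> _ _ cong valid, of "1 - t" 1] t unfolding N_def by auto
  qed
  have C: "C \<in> sets (Leb P)" "emeasure (Leb P) C = 1"
    using emeasure_Leb_box[OF fin, of 0 1] unfolding C_def by auto
  have L: "L R \<in> sets (Leb R)" if "R \<subseteq> P" for R
    unfolding L_def using fR[OF that] by (intro sets_greedy_success) auto
  have B: "B R \<in> sets (Leb (P - R))" "emeasure (Leb (P - R)) (B R) = ennreal ((1 - t) ^ card (P - R))" if "R \<subseteq> P" for R
    unfolding B_def using emeasure_Leb_box[OF fR(2)[OF that], of 0 "1 - t"] t by auto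
  have D: "D R \<in> sets (Leb P)" if "R \<subseteq> P" for R
    unfolding D_def by (intro Leb_split(2) fin that L B)
  have D_le: "emeasure (Leb P) (D R) \<le> ennreal (t ^ card R * (1 - t) ^ card (P - R)) *
    emeasure (Leb P) {w \<in> P \<rightarrow>\<^sub>E {0..1}. greedy_success P r R w}" if R: "R \<subseteq> P" for R
  proof -
    let ?W = "{w \<in> R \<rightarrow>\<^sub>E {0<..1::real}. greedy_success P r R w}"
    let ?U = "(P - R) \<rightarrow>\<^sub>E {0..1::real}"
    have W: "?W \<in> sets (Leb R)" using fR[OF R] by (intro sets_greedy_success) auto
    have U: "?U \<in> sets (Leb (P - R))" "emeasure (Leb (P - R)) ?U = 1"
      using fR[OF R] by (auto intro!: sets_PiM_I_finite simp: Leb.emeasure_PiM)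
    have "emeasure (Leb R) ?W = emeasure (Leb R) ?W * emeasure (Leb (P - R)) ?U" using U by simp
    also have "\<dots> = emeasure (Leb P) {w \<in> space (Leb P). restrict w R \<in> ?W \<and> restrict w (P - R) \<in> ?U}"
      by (rule Leb_split(1)[symmetric]) (intro fin R W U)+
    also have "\<dots> \<le> emeasure (Leb P) {w \<in> P \<rightarrow>\<^sub>E {0..1}. greedy_success P r R w}"
    proof (rule emeasure_mono)
      show "{w \<in> space (Leb P). restrict w R \<in> ?W \<and> restrict w (P - R) \<in> ?U}
        \<subseteq> {w \<in> P \<rightarrow>\<^sub>E {0..1}. greedy_success P r R w}"
      proof
        fix w assume "w \<in> {w \<in> space (Leb P). restrict w R \<in> ?W \<and> restrict w (P - R) \<in> ?U}"
        then have w: "w \<in> space (Leb P)" "restrict w R \<in> R \<rightarrow>\<^sub>E {0<..1}" "restrict w (P - R) \<in> ?U"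
          and s: "greedy_success P r R (restrict w R)" by blast+
        have "w x \<in> {0..1}" if "x \<in> P" for x
          using PiE_mem[OF w(2), of x] PiE_mem[OF w(3), of x] that by (cases "x \<in> R") auto
        then have "w \<in> P \<rightarrow>\<^sub>E {0..1}" using w(1) by (auto simp: space_PiM PiE_iff)
        then show "w \<in> {w \<in> P \<rightarrow>\<^sub>E {0..1}. greedy_success P r R w}"
          using s greedy_success_cong[of R "restrict w R" w] by simp
      qed
    qed (use fin R in \<open>intro sets_greedy_success; auto\<close>)
    finally have W_le: "emeasure (Leb R) ?W \<le> emeasure (Leb P) {w \<in> P \<rightarrow>\<^sub>E {0..1}. greedy_success P r R w}" .
    have "emeasure (Leb P) (D R) = emeasure (Leb R) (L R) * emeasure (Leb (P - R)) (B R)"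
      unfolding D_def by (intro Leb_split(1) fin R L B)
    also have "\<dots> = ennreal (t ^ card R * (1 - t) ^ card (P - R)) * emeasure (Leb R) ?W"
      unfolding L_def using greedy_success_rescale[OF fR(1)[OF R] t(1)] B(2)[OF R] t
      by (simp add: ennreal_mult mult_ac)
    also have "\<dots> \<le> ennreal (t ^ card R * (1 - t) ^ card (P - R)) *
      emeasure (Leb P) {w \<in> P \<rightarrow>\<^sub>E {0..1}. greedy_success P r R w}"
      by (intro mult_left_mono W_le) simp
    finally show ?thesis .
  qed
  have disj: "disjoint_family_on D (Pow P)"
    unfolding disjoint_family_on_def
  proof (intro ballI impI)
    have R: "R = {x \<in> P. 1 - t \<le> l x}" if "R \<subseteq> P" "l \<in> D R" for R l
    proof -
      have m: "restrict l R \<in> R \<rightarrow>\<^sub>E {1 - t..<1}" "restrict l (P - R) \<in> (P - R) \<rightarrow>\<^sub>E {0..<1 - t}"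
        using that(2) by (auto simp: D_def L_def B_def)
      have "1 - t \<le> l x" if "x \<in> R" for x using PiE_mem[OF m(1) that] that by simp
      moreover have "l x < 1 - t" if "x \<in> P - R" for x using PiE_mem[OF m(2) that] that by simp
      ultimately show ?thesis using that(1) by force
    qed
    fix R R' assume "R \<in> Pow P" "R' \<in> Pow P" "R \<noteq> R'"
    then show "D R \<inter> D R' = {}" using R[of R] R[of R'] by blast
  qed
  have AE_D: "AE l in Leb P. l \<in> C - N \<longrightarrow> l \<in> (\<Union>R\<in>Pow P. D R)"
    using AE_Leb_inj_on[OF fin]
  proof eventually_elim
    case (elim l)
    show ?case
    proof
      assume l: "l \<in> C - N"
      then have l01: "0 \<le> l x \<and> l x < 1" if "x \<in> P" for x
        using PiE_mem[of l P "\<lambda>_. {0..<1}" x] that by (auto simp: C_def)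
      define R where "R = {x \<in> P. 1 - t \<le> l x}"
      from l obtain y where y: "y \<in> P" "1 - t \<le> l y" "greedy_guess P r {z \<in> P. l y < l z} (\<lambda>x. - l x) = y"
        unfolding C_def N_def no_correct_guess_def \<gamma>_def by auto
      have "{z \<in> P. l y < l z} = {z \<in> R. - l z < - l y}" using y(2) by (auto simp: R_def)
      then have "greedy_success P r R (\<lambda>x. - l x)"
        unfolding greedy_success_def using y elim
        by (intro greedy_guess_correct[OF fin po, of R _ y]) (auto simp: R_def inj_on_def)
      then have "greedy_success P r R (\<lambda>x. - restrict l R x)"
        using greedy_success_cong[of R "\<lambda>x. - l x" "\<lambda>x. - restrict l R x"] by simp
      moreover have "restrict l R \<in> R \<rightarrow>\<^sub>E {1 - t..<1}"
        using l01 by (auto simp: R_def)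
      moreover have "restrict l (P - R) \<in> (P - R) \<rightarrow>\<^sub>E {0..<1 - t}"
        using l01 by (auto simp: R_def)
      moreover have "l \<in> space (Leb P)" using l by (auto simp: C_def space_PiM PiE_iff)
      ultimately have "l \<in> D R" by (simp add: D_def L_def B_def)
      then show "l \<in> (\<Union>R\<in>Pow P. D R)" by (auto simp: R_def)
    qed
  qed
  have "ennreal t = ennreal 1 - ennreal (1 - t)" using t by (subst ennreal_minus) auto
  also have "\<dots> = emeasure (Leb P) C - emeasure (Leb P) N" using C N by simp
  also have "\<dots> = emeasure (Leb P) (C - N)"
    using C N by (intro emeasure_Diff[symmetric]) (auto simp: N_def C_def)
  also have "\<dots> \<le> emeasure (Leb P) (\<Union>R\<in>Pow P. D R)"
    using AE_D D fin by (intro emeasure_mono_AE) auto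
  also have "\<dots> = (\<Sum>R\<in>Pow P. emeasure (Leb P) (D R))"
    using D fin disj by (intro sum_emeasure[symmetric]) auto
  also have "\<dots> \<le> (\<Sum>R\<in>Pow P. ennreal (t ^ card R * (1 - t) ^ card (P - R)) *
    emeasure (Leb P) {w \<in> P \<rightarrow>\<^sub>E {0..1}. greedy_success P r R w})"
    by (intro sum_mono D_le) auto
  finally show ?thesis .
qed

section \<open>The accepted element for fixed weights\<close>

definition online_success :: "'a set \<Rightarrow> 'a rel \<Rightarrow> ('a \<Rightarrow> real) \<Rightarrow> ('a \<Rightarrow> real) \<Rightarrow> bool" where
  "online_success P r \<tau> w \<longleftrightarrow> (\<exists>x. accepts P r \<tau> w x \<and> maximal_in P r x)"

lemma online_success_cong:
  assumes \<tau>: "\<And>x y. x \<in> P \<Longrightarrow> y \<in> P \<Longrightarrow> \<tau> x < \<tau> y \<longleftrightarrow> \<tau>' x < \<tau>' y"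
    and s: "\<And>x. x \<in> P \<Longrightarrow> 1 / exp 1 < \<tau> x \<longleftrightarrow> 1 / exp 1 < \<tau>' x"
    and w: "\<And>x y. x \<in> P \<Longrightarrow> y \<in> P \<Longrightarrow> w x < w y \<longleftrightarrow> w' x < w' y"
  shows "online_success P r \<tau> w \<longleftrightarrow> online_success P r \<tau>' w'"
proof -
  have acc: "acceptable P r \<tau> w x \<longleftrightarrow> acceptable P r \<tau>' w' x" for x
  proof (cases "x \<in> P")
    case True
    then have ex: "exposed P \<tau> x = exposed P \<tau>' x"
      using \<tau> by (auto simp: exposed_def not_less[symmetric])
    have "is_greedy_maximum (exposed P \<tau>' x) r' w x \<longleftrightarrow> is_greedy_maximum (exposed P \<tau>' x) r' w' x" for r'
      by (rule is_greedy_maximum_cong) (auto simp: exposed_def w)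
    then show ?thesis unfolding acceptable_def ex using s[OF True] by simp
  qed (simp add: acceptable_def)
  have "accepts P r \<tau> w x \<longleftrightarrow> accepts P r \<tau>' w' x" for x
    unfolding accepts_def is_arg_min_def acc using \<tau> by (auto simp: acceptable_def)
  then show ?thesis by (simp add: online_success_def)
qed

text \<open>
  A summand belongs to a set \<open>R\<close> whose greedy maximum \<open>x = g R\<close> is maximal in \<open>P\<close>; it is a lower bound
  for the volume of the set \<open>D R\<close> of arrival times for which \<open>x\<close> is accepted and \<open>R\<close> is exactly the set exposed when \<open>x\<close> arrives.
  Let \<open>x\<close> arrive at time \<open>u > s\<close>.  The elements outside \<open>R\<close> arrive after \<open>u\<close>, which gives the power of
  \<open>1 - u\<close>.  The elements of \<open>R - {x}\<close> arrive before \<open>u\<close>, and none of them may have been acceptable.  Viewed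
  backwards in time, this is a guessing game in which one guesses that the last arrival among the
  elements still present is their greedy maximum.  Never being right after time \<open>s\<close> has volume
  \<open>s * u ^ (card R - 2)\<close>, or \<open>1 \<ge> s / u\<close> if \<open>R = {x}\<close>.
\<close>

lemma online_success_volume:
  fixes w :: "'a \<Rightarrow> real"
  defines "s \<equiv> 1 / exp (1::real)"
  assumes fin: "finite P" and po: "partial_order_on P r" and inj: "inj_on w P"
    and S: "{\<tau> \<in> P \<rightarrow>\<^sub>E {0..1}. online_success P r \<tau> w} \<in> sets (Leb P)"
  shows "(\<Sum>R | R \<subseteq> P \<and> greedy_success P r R w.
       \<integral>\<^sup>+ u. ennreal (s / u\<^sup>2 * (u ^ card R * (1 - u) ^ card (P - R))) * indicator {s<..<1} u \<partial>lborel)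
    \<le> emeasure (Leb P) {\<tau> \<in> P \<rightarrow>\<^sub>E {0..1}. online_success P r \<tau> w}"
proof -
  have s: "0 < s" "s < 1" by (auto simp: s_def)
  define g where "g R = (THE z. is_greedy_maximum R r w z)" for R
  define \<R> where "\<R> = {R. R \<subseteq> P \<and> greedy_success P r R w}"
  have g: "g R = z" if "R \<subseteq> P" "is_greedy_maximum R r w z" for R z
  proof -
    have "R \<noteq> {}" using is_greedy_maximum_mem[OF that(2)] by blast
    then have "\<exists>!z. is_greedy_maximum R r w z"
      using that(1) inj fin by (intro ex1_greedy_maximum_subset[OF po]) (auto intro: finite_subset inj_on_subset)
    then show ?thesis unfolding g_def using that(2) by (rule the1_equality)
  qed
  have gmem: "g R \<in> R" if "R \<subseteq> P" "R \<noteq> {}" for R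
  proof -
    have "\<exists>!z. is_greedy_maximum R r w z"
      using that inj fin by (intro ex1_greedy_maximum_subset[OF po]) (auto intro: finite_subset inj_on_subset)
    then show ?thesis using g[OF that(1)] is_greedy_maximum_mem by metis
  qed
  have \<R>: "R \<subseteq> P" "g R \<in> R" "is_greedy_maximum R r w (g R)" "maximal_in P r (g R)" if "R \<in> \<R>" for R
    using that g is_greedy_maximum_mem by (auto simp: \<R>_def greedy_success_def)
  define \<gamma> where "\<gamma> R A = (\<lambda>\<tau> :: 'a \<Rightarrow> real. g (R - A))" for R A
  define N where "N R \<tau> \<longleftrightarrow> no_correct_guess (R - {g R}) (\<gamma> (R - {g R})) s \<tau>" for R \<tau>
  define D where "D R = {\<tau> \<in> P \<rightarrow>\<^sub>E {0..<1}. s < \<tau> (g R) \<and> (\<forall>y\<in>R - {g R}. \<tau> y < \<tau> (g R)) \<and>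
    (\<forall>y\<in>P - R. \<tau> (g R) < \<tau> y) \<and> N R \<tau>}" for R
  have D_R: "R = {y \<in> P. \<tau> y \<le> \<tau> (g R)}" if "R \<in> \<R>" "\<tau> \<in> D R" for R \<tau>
  proof -
    have "\<tau> y \<le> \<tau> (g R)" if "y \<in> R" for y
      using \<open>\<tau> \<in> D R\<close> that by (cases "y = g R") (auto simp: D_def less_imp_le)
    moreover have "\<not> \<tau> y \<le> \<tau> (g R)" if "y \<in> P - R" for y
      using \<open>\<tau> \<in> D R\<close> that by (auto simp: D_def not_le)
    ultimately show ?thesis using \<R>(1)[OF that(1)] by blast
  qed
  \<comment> \<open>if all backward guesses fail, nothing acceptable arrives between \<open>s\<close> and the arrival of \<open>g R\<close>\<close>
  have not_before: "\<not> is_greedy_maximum {z \<in> P. \<tau> z \<le> \<tau> y} r w y"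
    if "R \<in> \<R>" "\<tau> \<in> D R" "y \<in> R - {g R}" "s \<le> \<tau> y" for R \<tau> y
  proof
    let ?R = "R - {g R}"
    assume gm: "is_greedy_maximum {z \<in> P. \<tau> z \<le> \<tau> y} r w y"
    have "\<tau> y < \<tau> (g R)" using that by (auto simp: D_def)
    then have "{z \<in> P. \<tau> z \<le> \<tau> y} = ?R - {z \<in> ?R. \<tau> y < \<tau> z}"
      using D_R[OF that(1,2)] by force
    then have "\<gamma> ?R {z \<in> ?R. \<tau> y < \<tau> z} \<tau> = y"
      unfolding \<gamma>_def using g[OF _ gm] by auto
    then show False using that by (auto simp: D_def N_def no_correct_guess_def)
  qed
  have D_success: "\<tau> \<in> {\<tau> \<in> P \<rightarrow>\<^sub>E {0..1}. online_success P r \<tau> w}" if R: "R \<in> \<R>" and \<tau>: "\<tau> \<in> D R" for R \<tau>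
  proof -
    have x: "s < \<tau> (g R)" "g R \<in> P" using \<tau> \<R>[OF R] by (auto simp: D_def)
    have "exposed P \<tau> (g R) = R" using D_R[OF R \<tau>] by (simp add: exposed_def)
    then have "acceptable P r \<tau> w (g R)"
      using x \<R>[OF R] by (simp add: acceptable_def is_greedy_maximum_Restr s_def)
    moreover have "\<not> \<tau> y < \<tau> (g R)" if "acceptable P r \<tau> w y" for y
    proof
      assume lt: "\<tau> y < \<tau> (g R)"
      have y: "y \<in> P" "s < \<tau> y" "is_greedy_maximum {z \<in> P. \<tau> z \<le> \<tau> y} r w y"
        using that unfolding acceptable_def is_greedy_maximum_Restr s_def exposed_def by auto
      have "y \<in> R - {g R}" using lt y(1) D_R[OF R \<tau>] by force
      from not_before[OF R \<tau> this] y show False by simp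
    qed
    ultimately have "accepts P r \<tau> w (g R)" by (auto simp: accepts_def is_arg_min_def)
    moreover have "\<tau> \<in> P \<rightarrow>\<^sub>E {0..1}"
    proof (rule subsetD)
      show "P \<rightarrow>\<^sub>E {0..<1} \<subseteq> P \<rightarrow>\<^sub>E {0..1::real}" by (rule PiE_mono) auto
      show "\<tau> \<in> P \<rightarrow>\<^sub>E {0..<1}" using \<tau> by (simp add: D_def)
    qed
    ultimately show ?thesis using \<R>(4)[OF R] by (auto simp: online_success_def)
  qed
  have disj: "disjoint_family_on D \<R>"
    unfolding disjoint_family_on_def
  proof (intro ballI impI)
    \<comment> \<open>otherwise \<open>g R\<close> would have been acceptable before \<open>g R'\<close> arrived\<close>
    have late: "\<not> \<tau> (g R) < \<tau> (g R')" if "R \<in> \<R>" "R' \<in> \<R>" "\<tau> \<in> D R" "\<tau> \<in> D R'" for R R' \<tau>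
    proof
      assume lt: "\<tau> (g R) < \<tau> (g R')"
      have "g R \<in> R' - {g R'}" using lt D_R[OF that(2,4)] \<R>(1,2)[OF that(1)] by force
      moreover have "s \<le> \<tau> (g R)" using that by (auto simp: D_def)
      ultimately show False
        using not_before[OF that(2,4), of "g R"] \<R>(3)[OF that(1)] D_R[OF that(1,3)] by simp
    qed
    fix R R' assume R: "R \<in> \<R>" "R' \<in> \<R>" "R \<noteq> R'"
    have False if "\<tau> \<in> D R" "\<tau> \<in> D R'" for \<tau>
    proof -
      have "\<tau> (g R) = \<tau> (g R')" using late[of R R' \<tau>] late[of R' R \<tau>] R that by force
      then show False using D_R[of R \<tau>] D_R[of R' \<tau>] R that by simp
    qed
    then show "D R \<inter> D R' = {}" by blast
  qed
  have D: "D R \<in> sets (Leb P)" if R: "R \<in> \<R>" for R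
  proof -
    let ?p = "\<lambda>\<tau>. (\<forall>y\<in>R - {g R}. \<tau> y < \<tau> (g R)) \<and> (\<forall>y\<in>P - R. \<tau> (g R) < \<tau> y) \<and> N R \<tau>"
    have "{\<tau> \<in> space (Leb P). ?p \<tau>} \<in> sets (Leb P)"
    proof (rule sets_order_determined[OF fin, where s=s])
      fix \<tau> \<tau>' :: "'a \<Rightarrow> real"
      assume *: "\<And>x y. x \<in> P \<Longrightarrow> y \<in> P \<Longrightarrow> \<tau> x < \<tau> y \<longleftrightarrow> \<tau>' x < \<tau>' y" "\<And>x. x \<in> P \<Longrightarrow> s \<le> \<tau> x \<longleftrightarrow> s \<le> \<tau>' x"
      let ?R = "R - {g R}"
      have RP: "?R \<subseteq> P" "g R \<in> P" using \<R>[OF R] by auto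
      have "{z \<in> ?R. \<tau> y < \<tau> z} = {z \<in> ?R. \<tau>' y < \<tau>' z}" if "y \<in> ?R" for y
        using * RP that by blast
      then have "N R \<tau> \<longleftrightarrow> N R \<tau>'"
        unfolding N_def no_correct_guess_def \<gamma>_def using *(2) RP by (intro ball_cong) auto
      then show "?p \<tau> = ?p \<tau>'" using * RP by (intro conj_cong ball_cong) auto
    qed
    moreover have "{\<tau> \<in> space (Leb P). s < \<tau> (g R)} \<in> sets (Leb P)"
      using \<R>[OF R] by (intro sets_comparison) auto
    moreover have "D R = (P \<rightarrow>\<^sub>E {0..<1}) \<inter> ({\<tau> \<in> space (Leb P). ?p \<tau>} \<inter> {\<tau> \<in> space (Leb P). s < \<tau> (g R)})"
      by (auto simp: D_def space_PiM)
    moreover have "P \<rightarrow>\<^sub>E {0..<1} \<in> sets (Leb P)" using emeasure_Leb_box(2)[OF fin, of 0 1] by simp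
    ultimately show ?thesis by auto
  qed
  have vol: "(\<integral>\<^sup>+ u. ennreal (s / u\<^sup>2 * (u ^ card R * (1 - u) ^ card (P - R))) * indicator {s<..<1} u \<partial>lborel)
    \<le> emeasure (Leb P) (D R)" if R: "R \<in> \<R>" for R
  proof -
    let ?x = "g R" let ?R = "R - {?x}" let ?P = "P - {?x}"
    have P: "insert ?x ?P = P" "?P - ?R = P - R" using \<R>[OF R] by auto
    have sub: "?R \<subseteq> ?P" using \<R>(1)[OF R] by blast
    have f: "finite ?P" "finite ?R" "finite (P - R)" "finite R"
      using fin \<R>(1)[OF R] finite_subset by auto
    have sec_sets: "{\<tau> \<in> space (Leb ?P). \<tau>(?x := u) \<in> D R} \<in> sets (Leb ?P)" for u
      using Leb_insert(2)[of ?P ?x "D R" u] f D[OF R] P by auto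
    have le: "ennreal (s / u\<^sup>2 * (u ^ card R * (1 - u) ^ card (P - R)))
      \<le> emeasure (Leb ?P) {\<tau> \<in> space (Leb ?P). \<tau>(?x := u) \<in> D R}" if u: "s < u" "u < 1" for u
    proof -
      let ?V = "{\<tau> \<in> ?R \<rightarrow>\<^sub>E {0..<u}. no_correct_guess ?R (\<gamma> ?R) s \<tau>}"
      let ?B = "(P - R) \<rightarrow>\<^sub>E {u<..<1}"
      have V: "?V \<in> sets (Leb ?R) \<and> ennreal (s / u\<^sup>2 * u ^ card R) \<le> emeasure (Leb ?R) ?V"
      \<comment> \<open>for \<open>R = {g R}\<close> no guess is made and the volume is \<open>1\<close>, which is more than \<open>s / u\<close>\<close>
      proof (cases "?R = {}")
        case True
        then have R1: "R = {?x}" using \<R>(2)[OF R] by auto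
        have "s / u\<^sup>2 * u ^ card R \<le> 1"
          by (subst R1) (use s u in \<open>simp add: power2_eq_square divide_le_eq\<close>)
        then have "ennreal (s / u\<^sup>2 * u ^ card R) \<le> 1" by simp
        then show ?thesis unfolding True by (simp add: no_correct_guess_def PiM_empty)
      next
        case False
        have c: "\<gamma> ?R A \<tau> = \<gamma> ?R A \<tau>'" for A \<tau> \<tau>' by (simp add: \<gamma>_def)
        have v: "\<gamma> ?R A \<tau> \<in> ?R - A" if "A \<subset> ?R" for A \<tau>
          unfolding \<gamma>_def by (rule gmem) (use that \<R>(1)[OF R] in auto)
        have "s / u\<^sup>2 * u ^ card R = s * u ^ (card ?R - 1)"
        proof -
          have "card ?R \<noteq> 0" using False f by simp
          moreover have "card R = Suc (card ?R)" using \<R>(2)[OF R] f by (metis card.remove)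
          ultimately have "card R = (card ?R - 1) + 2" by simp
          then have "u ^ card R = u ^ (card ?R - 1) * u\<^sup>2" by (simp only: power_add)
          then show ?thesis using u s by simp
        qed
        then show ?thesis
          using order_guess_volume[OF f(2) False, of s u "\<gamma> ?R", OF _ _ c v] s u by simp
      qed
      have B: "?B \<in> sets (Leb (P - R))" "emeasure (Leb (P - R)) ?B = ennreal ((1 - u) ^ card (P - R))"
        using f u by (auto intro!: sets_PiM_I_finite simp: Leb.emeasure_PiM ennreal_power)
      have "ennreal (s / u\<^sup>2 * (u ^ card R * (1 - u) ^ card (P - R)))
        = ennreal (s / u\<^sup>2 * u ^ card R) * ennreal ((1 - u) ^ card (P - R))"
        using s u by (subst ennreal_mult[symmetric]) (auto simp: mult.assoc)
      also have "\<dots> \<le> emeasure (Leb ?R) ?V * emeasure (Leb (P - R)) ?B"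
        unfolding B(2) using V by (intro mult_right_mono) auto
      also have "\<dots> = emeasure (Leb ?P) {\<tau> \<in> space (Leb ?P). restrict \<tau> ?R \<in> ?V \<and> restrict \<tau> (P - R) \<in> ?B}"
        by (rule Leb_split(1)[OF f(1) sub, unfolded P(2), OF conjunct1[OF V] B(1), symmetric])
      also have "\<dots> \<le> emeasure (Leb ?P) {\<tau> \<in> space (Leb ?P). \<tau>(?x := u) \<in> D R}"
      proof (rule emeasure_mono[OF _ sec_sets], rule subsetI)
        fix \<tau> assume "\<tau> \<in> {\<tau> \<in> space (Leb ?P). restrict \<tau> ?R \<in> ?V \<and> restrict \<tau> (P - R) \<in> ?B}"
        then have \<tau>: "\<tau> \<in> space (Leb ?P)" "restrict \<tau> ?R \<in> ?R \<rightarrow>\<^sub>E {0..<u}" "restrict \<tau> (P - R) \<in> ?B"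
          and n: "no_correct_guess ?R (\<gamma> ?R) s (restrict \<tau> ?R)" by blast+
        let ?\<tau> = "\<tau>(?x := u)"
        have early: "0 \<le> \<tau> y \<and> \<tau> y < u" if "y \<in> ?R" for y using PiE_mem[OF \<tau>(2) that] that by simp
        have late: "u < \<tau> y \<and> \<tau> y < 1" if "y \<in> P - R" for y using PiE_mem[OF \<tau>(3) that] that by simp
        have "?\<tau> y \<in> {0..<1}" if "y \<in> P" for y
          using early[of y] late[of y] that u s by (cases "y = ?x"; cases "y \<in> R") auto
        moreover have "?\<tau> \<in> extensional P" using \<tau>(1) P(1) by (auto simp: space_PiM PiE_iff extensional_def)
        moreover have "N R ?\<tau>"
        proof -
          have "{z \<in> ?R. restrict \<tau> ?R y < restrict \<tau> ?R z} = {z \<in> ?R. ?\<tau> y < ?\<tau> z}" if "y \<in> ?R" for y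
            using that by auto
          then show ?thesis using n unfolding N_def no_correct_guess_def \<gamma>_def by auto
        qed
        ultimately have "?\<tau> \<in> D R"
          using early late u(1) \<R>(2)[OF R] unfolding D_def by (auto simp: PiE_iff)
        then show "\<tau> \<in> {\<tau> \<in> space (Leb ?P). \<tau>(?x := u) \<in> D R}" using \<tau>(1) by simp
      qed
      finally show ?thesis .
    qed
    have "(\<integral>\<^sup>+ u. ennreal (s / u\<^sup>2 * (u ^ card R * (1 - u) ^ card (P - R))) * indicator {s<..<1} u \<partial>lborel)
      \<le> (\<integral>\<^sup>+ u. emeasure (Leb ?P) {\<tau> \<in> space (Leb ?P). \<tau>(?x := u) \<in> D R} \<partial>lborel)"
      by (rule nn_integral_mono) (use le in \<open>auto simp: indicator_def\<close>)
    also have "\<dots> = emeasure (Leb P) (D R)"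
      using Leb_insert(1)[of ?P ?x "D R"] f D[OF R] P by simp
    finally show ?thesis .
  qed
  have fR: "finite \<R>" using fin by (simp add: \<R>_def)
  have "(\<Sum>R\<in>\<R>. \<integral>\<^sup>+ u. ennreal (s / u\<^sup>2 * (u ^ card R * (1 - u) ^ card (P - R))) * indicator {s<..<1} u \<partial>lborel)
    \<le> (\<Sum>R\<in>\<R>. emeasure (Leb P) (D R))"
    by (intro sum_mono vol)
  also have "\<dots> = emeasure (Leb P) (\<Union>R\<in>\<R>. D R)"
    using D fR disj by (intro sum_emeasure) auto
  also have "\<dots> \<le> emeasure (Leb P) {\<tau> \<in> P \<rightarrow>\<^sub>E {0..1}. online_success P r \<tau> w}"
    by (rule emeasure_mono[OF _ S]) (use D_success in blast)
  finally show ?thesis by (simp add: \<R>_def)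
qed

section \<open>Averaging over the weights\<close>

abbreviation unif :: "real measure" where
  "unif \<equiv> uniform_measure lborel {0..1}"

lemma emeasure_PiM_unif:
  assumes fin: "finite P" and A: "A \<in> sets (Leb P)"
  shows "emeasure (Pi\<^sub>M P (\<lambda>_. unif)) A = emeasure (Leb P) (A \<inter> (P \<rightarrow>\<^sub>E {0..1}))"
proof -
  interpret unif: prob_space unif by (rule prob_space_uniform_measure) auto
  interpret U: product_sigma_finite "\<lambda>_::'a. unif" ..
  have C: "P \<rightarrow>\<^sub>E {0..1} \<in> sets (Leb P)" using fin by (intro sets_PiM_I_finite) auto
  have "density (Leb P) (indicator (P \<rightarrow>\<^sub>E {0..1})) = Pi\<^sub>M P (\<lambda>_. unif)"
  proof (rule U.PiM_eqI[OF fin])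
    show "sets (density (Leb P) (indicator (P \<rightarrow>\<^sub>E {0..1}))) = sets (Pi\<^sub>M P (\<lambda>_. unif))"
      by (simp, rule sets_PiM_cong) auto
    fix A :: "'a \<Rightarrow> real set" assume A: "\<And>i. i \<in> P \<Longrightarrow> A i \<in> sets unif"
    have "(P \<rightarrow>\<^sub>E {0..1}) \<inter> Pi\<^sub>E P A = Pi\<^sub>E P (\<lambda>i. {0..1} \<inter> A i)" by (simp add: PiE_Int)
    moreover have "Pi\<^sub>E P A \<in> sets (Leb P)" "Pi\<^sub>E P (\<lambda>i. {0..1} \<inter> A i) \<in> sets (Leb P)"
      using A fin by (auto intro!: sets_PiM_I_finite)
    ultimately have "emeasure (density (Leb P) (indicator (P \<rightarrow>\<^sub>E {0..1}))) (Pi\<^sub>E P A)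
      = emeasure (Leb P) (Pi\<^sub>E P (\<lambda>i. {0..1} \<inter> A i))"
      using C by (simp add: emeasure_density indicator_inter_arith[symmetric])
    also have "\<dots> = (\<Prod>i\<in>P. emeasure lborel ({0..1} \<inter> A i))"
      using A fin by (subst Leb.emeasure_PiM) auto
    also have "\<dots> = (\<Prod>i\<in>P. emeasure unif (A i))"
      using A by (intro prod.cong) (auto simp: divide_ennreal_def)
    finally show "emeasure (density (Leb P) (indicator (P \<rightarrow>\<^sub>E {0..1}))) (Pi\<^sub>E P A) = (\<Prod>i\<in>P. emeasure unif (A i))" .
  qed
  then have "emeasure (Pi\<^sub>M P (\<lambda>_. unif)) A = emeasure (density (Leb P) (indicator (P \<rightarrow>\<^sub>E {0..1}))) A" by simp
  also have "\<dots> = (\<integral>\<^sup>+ x. indicator (P \<rightarrow>\<^sub>E {0..1}) x * indicator A x \<partial>Leb P)"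
    using A C by (intro emeasure_density) auto
  also have "\<dots> = (\<integral>\<^sup>+ x. indicator (A \<inter> (P \<rightarrow>\<^sub>E {0..1})) x \<partial>Leb P)"
    by (intro nn_integral_cong) (auto simp: indicator_def)
  also have "\<dots> = emeasure (Leb P) (A \<inter> (P \<rightarrow>\<^sub>E {0..1}))"
    using A C by (intro nn_integral_indicator) auto
  finally show ?thesis .
qed

lemma sets_online_success:
  assumes "finite P"
  shows "{z \<in> space (Leb P \<Otimes>\<^sub>M Leb P). online_success P r (fst z) (snd z)} \<in> sets (Leb P \<Otimes>\<^sub>M Leb P)"
proof (rule sets_finitely_determined)
  let ?K = "(\<lambda>(x, y) z. fst z x < fst z y) ` (P \<times> P) \<union> (\<lambda>(x, y) z. snd z x < snd z y) ` (P \<times> P)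
    \<union> (\<lambda>x z. 1 / exp 1 < fst z x) ` P :: (('a \<Rightarrow> real) \<times> ('a \<Rightarrow> real) \<Rightarrow> bool) set"
  show "finite ?K" using assms by blast
  have c: "(\<lambda>z. fst z x) \<in> borel_measurable (Leb P \<Otimes>\<^sub>M Leb P)" "(\<lambda>z. snd z x) \<in> borel_measurable (Leb P \<Otimes>\<^sub>M Leb P)"
    if "x \<in> P" for x
    using that by measurable
  show "{z \<in> space (Leb P \<Otimes>\<^sub>M Leb P). \<phi> z} \<in> sets (Leb P \<Otimes>\<^sub>M Leb P)" if "\<phi> \<in> ?K" for \<phi>
    using that c by (auto intro!: borel_measurable_less)
  fix z z' :: "('a \<Rightarrow> real) \<times> ('a \<Rightarrow> real)" assume *: "\<And>\<phi>. \<phi> \<in> ?K \<Longrightarrow> \<phi> z = \<phi> z'"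
  show "online_success P r (fst z) (snd z) = online_success P r (fst z') (snd z')"
  proof (rule online_success_cong)
    show "fst z x < fst z y \<longleftrightarrow> fst z' x < fst z' y" if "x \<in> P" "y \<in> P" for x y
      by (rule *[of "\<lambda>z. fst z x < fst z y"]) (use that in force)
    show "snd z x < snd z y \<longleftrightarrow> snd z' x < snd z' y" if "x \<in> P" "y \<in> P" for x y
      by (rule *[of "\<lambda>z. snd z x < snd z y"]) (use that in force)
    show "1 / exp 1 < fst z x \<longleftrightarrow> 1 / exp 1 < fst z' x" if "x \<in> P" for x
      by (rule *[of "\<lambda>z. 1 / exp 1 < fst z x"]) (use that in force)
  qed
qed

text \<open>
  Averaging \<open>online_success_volume\<close> over the weights replaces the condition on \<open>R\<close> by the probability that
  the greedy maximum of \<open>R\<close> is maximal in \<open>P\<close>.  At a fixed time \<open>u\<close> the sum over \<open>R\<close> is then the sum of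
  \<open>random_subset_greedy_success\<close>, hence at least \<open>u\<close>.
\<close>

lemma online_success_probability:
  assumes fin: "finite P" and "P \<noteq> {}" and po: "partial_order_on P r"
  defines "\<mu> \<equiv> Pi\<^sub>M P (\<lambda>_. unif)"
  shows "ennreal (1 / exp 1) \<le>
    emeasure (\<mu> \<Otimes>\<^sub>M \<mu>) {z \<in> space (Leb P \<Otimes>\<^sub>M Leb P). online_success P r (fst z) (snd z)}"
proof -
  define s where "s = 1 / exp (1::real)"
  have s: "0 < s" "s < 1" "ln s = - 1" by (auto simp: s_def ln_div)
  interpret unif: prob_space unif by (rule prob_space_uniform_measure) auto
  interpret mu: prob_space \<mu> unfolding \<mu>_def by (rule prob_space_PiM) (rule unif.prob_space_axioms)
  interpret pair: pair_sigma_finite \<mu> \<mu> ..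
  have sets_mu: "sets \<mu> = sets (Leb P)" unfolding \<mu>_def by (rule sets_PiM_cong) auto
  have space_mu: "space \<mu> = space (Leb P)" by (rule sets_eq_imp_space_eq[OF sets_mu])
  let ?A = "{z \<in> space (Leb P \<Otimes>\<^sub>M Leb P). online_success P r (fst z) (snd z)}"
  have A: "?A \<in> sets (\<mu> \<Otimes>\<^sub>M \<mu>)"
    using sets_online_success[OF fin, of r] sets_pair_measure_cong[OF sets_mu sets_mu] by simp
  define c where "c R u = s / u\<^sup>2 * (u ^ card R * (1 - u) ^ card (P - R))" for R u
  define I where "I R = (\<integral>\<^sup>+ u. ennreal (c R u) * indicator {s<..<1} u \<partial>lborel)" for R
  define G where "G R = {w \<in> space (Leb P). greedy_success P r R w}" for R
  have G: "G R \<in> sets (Leb P)" if "R \<subseteq> P" for R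
    using sets_greedy_success(1)[OF fin that, of UNIV P r] by (simp add: G_def space_PiM)
  have G': "G R \<in> sets \<mu>" if "R \<in> Pow P" for R using G[of R] that unfolding sets_mu by blast
  have sec: "(\<Sum>R\<in>Pow P. I R * indicator (G R) w) \<le> emeasure \<mu> ((\<lambda>\<tau>. (\<tau>, w)) -` ?A)"
    if w: "w \<in> space \<mu>" "inj_on w P" for w
  proof -
    let ?S = "{\<tau> \<in> P \<rightarrow>\<^sub>E {0..1}. online_success P r \<tau> w}"
    have A': "(\<lambda>\<tau>. (\<tau>, w)) -` ?A \<in> sets (Leb P)"
      using sets_Pair2[OF A, of w] sets_mu by simp
    have eq: "(\<lambda>\<tau>. (\<tau>, w)) -` ?A \<inter> (P \<rightarrow>\<^sub>E {0..1}) = ?S"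
      using w(1) by (auto simp: space_pair_measure space_mu space_PiM PiE_iff extensional_def)
    have S: "?S \<in> sets (Leb P)"
      unfolding eq[symmetric] using fin by (intro sets.Int A' sets_PiM_I_finite) auto
    have "(\<Sum>R\<in>Pow P. I R * indicator (G R) w) = (\<Sum>R | R \<subseteq> P \<and> greedy_success P r R w. I R)"
      using w(1) fin by (intro sum.mono_neutral_cong_right) (auto simp: G_def space_mu)
    also have "\<dots> \<le> emeasure (Leb P) ?S"
      using online_success_volume[OF fin po w(2) S] unfolding I_def c_def s_def .
    also have "\<dots> = emeasure \<mu> ((\<lambda>\<tau>. (\<tau>, w)) -` ?A)"
      unfolding \<mu>_def emeasure_PiM_unif[OF fin A'] eq ..
    finally show ?thesis .
  qed
  have inj: "AE w in \<mu>. inj_on w P"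
  proof -
    obtain N where N: "{w \<in> space (Leb P). \<not> inj_on w P} \<subseteq> N" "emeasure (Leb P) N = 0" "N \<in> sets (Leb P)"
      using AE_Leb_inj_on[OF fin] by (rule AE_E)
    have "emeasure \<mu> N = emeasure (Leb P) (N \<inter> (P \<rightarrow>\<^sub>E {0..1}))"
      unfolding \<mu>_def by (rule emeasure_PiM_unif[OF fin N(3)])
    also have "\<dots> \<le> emeasure (Leb P) N" using N(3) by (intro emeasure_mono) auto
    finally have "emeasure \<mu> N = 0" using N(2) by simp
    then show ?thesis using N sets_mu space_mu by (intro AE_I[where N=N]) auto
  qed
  have I_int: "(\<lambda>u. ennreal (c R u) * indicator {s<..<1} u) \<in> borel_measurable lborel" for R
    unfolding c_def by measurable
  \<comment> \<open>the threshold \<open>1 / e\<close> is chosen such that the integral of \<open>1 / u\<close> from the threshold to \<open>1\<close> is \<open>1\<close>\<close>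
  have "ennreal s = (\<integral>\<^sup>+ u. ennreal (s / u) * indicator {s..1} u \<partial>lborel)"
  proof -
    have "(\<integral>\<^sup>+ u. ennreal (s / u) * indicator {s..1} u \<partial>lborel) = ennreal (s * ln 1 - s * ln s)"
    proof (rule nn_integral_FTC_Icc)
      show "((\<lambda>u. s * ln u) has_real_derivative s / x) (at x)" if "x \<in> {s..1}" for x
        using that s by (auto intro!: derivative_eq_intros)
    qed (use s in auto)
    then show ?thesis using s by simp
  qed
  also have "\<dots> = (\<integral>\<^sup>+ u. ennreal (s / u) * indicator {s<..<1} u \<partial>lborel)"
  proof (rule nn_integral_cong_AE)
    show "AE u in lborel. ennreal (s / u) * indicator {s..1} u = ennreal (s / u) * indicator {s<..<1} u"
      using AE_lborel_singleton[of s] AE_lborel_singleton[of 1]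
      by eventually_elim (auto simp: indicator_def)
  qed
  also have "\<dots> \<le> (\<integral>\<^sup>+ u. (\<Sum>R\<in>Pow P. ennreal (c R u) * indicator {s<..<1} u * emeasure \<mu> (G R)) \<partial>lborel)"
  proof (rule nn_integral_mono)
    fix u :: real
    show "ennreal (s / u) * indicator {s<..<1} u
      \<le> (\<Sum>R\<in>Pow P. ennreal (c R u) * indicator {s<..<1} u * emeasure \<mu> (G R))"
    proof (cases "u \<in> {s<..<1}")
      case True
      then have u: "0 < u" "u < 1" using s by auto
      have muG: "emeasure \<mu> (G R) = emeasure (Leb P) {w \<in> P \<rightarrow>\<^sub>E {0..1}. greedy_success P r R w}" if "R \<subseteq> P" for R
        unfolding \<mu>_def emeasure_PiM_unif[OF fin G[OF that]]
        by (intro arg_cong[where f="emeasure _"]) (auto simp: G_def space_PiM)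
      have le: "ennreal u \<le> (\<Sum>R\<in>Pow P. ennreal (u ^ card R * (1 - u) ^ card (P - R)) * emeasure \<mu> (G R))"
      proof -
        have "(\<Sum>R\<in>Pow P. ennreal (u ^ card R * (1 - u) ^ card (P - R)) * emeasure \<mu> (G R))
          = (\<Sum>R\<in>Pow P. ennreal (u ^ card R * (1 - u) ^ card (P - R)) *
              emeasure (Leb P) {w \<in> P \<rightarrow>\<^sub>E {0..1}. greedy_success P r R w})"
          using muG by (intro sum.cong) auto
        then show ?thesis
          using random_subset_greedy_success[OF fin \<open>P \<noteq> {}\<close> po, of u] u by simp
      qed
      have "ennreal (s / u) = ennreal (s / u\<^sup>2) * ennreal u"
        using s u by (simp add: ennreal_mult[symmetric] power2_eq_square)
      also have "\<dots> \<le> ennreal (s / u\<^sup>2) *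
        (\<Sum>R\<in>Pow P. ennreal (u ^ card R * (1 - u) ^ card (P - R)) * emeasure \<mu> (G R))"
        by (intro mult_left_mono le) simp
      also have "\<dots> = (\<Sum>R\<in>Pow P. ennreal (c R u) * emeasure \<mu> (G R))"
      proof -
        have "ennreal (c R u) = ennreal (s / u\<^sup>2) * ennreal (u ^ card R * (1 - u) ^ card (P - R))" for R
          unfolding c_def using s u by (intro ennreal_mult) auto
        then show ?thesis by (simp add: sum_distrib_left mult.assoc)
      qed
      finally show ?thesis using True by simp
    qed simp
  qed
  also have "\<dots> = (\<Sum>R\<in>Pow P. (\<integral>\<^sup>+ u. ennreal (c R u) * indicator {s<..<1} u * emeasure \<mu> (G R) \<partial>lborel))"
    by (intro nn_integral_sum borel_measurable_times_ennreal I_int borel_measurable_const)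
  also have "\<dots> = (\<Sum>R\<in>Pow P. I R * emeasure \<mu> (G R))"
    unfolding I_def using I_int by (intro sum.cong refl nn_integral_multc)
  also have "\<dots> = (\<Sum>R\<in>Pow P. (\<integral>\<^sup>+ w. I R * indicator (G R) w \<partial>\<mu>))"
    using G' by (intro sum.cong refl nn_integral_cmult_indicator[symmetric]) blast
  also have "\<dots> = (\<integral>\<^sup>+ w. (\<Sum>R\<in>Pow P. I R * indicator (G R) w) \<partial>\<mu>)"
    using G' by (intro nn_integral_sum[symmetric] borel_measurable_times_ennreal borel_measurable_const
        borel_measurable_indicator) blast
  also have "\<dots> \<le> (\<integral>\<^sup>+ w. emeasure \<mu> ((\<lambda>\<tau>. (\<tau>, w)) -` ?A) \<partial>\<mu>)"
  proof (rule nn_integral_mono_AE)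
    show "AE w in \<mu>. (\<Sum>R\<in>Pow P. I R * indicator (G R) w) \<le> emeasure \<mu> ((\<lambda>\<tau>. (\<tau>, w)) -` ?A)"
      by (rule AE_mp[OF inj], rule AE_I2, rule impI, rule sec)
  qed
  also have "\<dots> = emeasure (\<mu> \<Otimes>\<^sub>M \<mu>) ?A"
    by (rule pair.emeasure_pair_measure_alt2[OF A, symmetric])
  finally show ?thesis by (simp add: s_def)
qed

theorem theorem1:
  fixes P :: "'a set" and r :: "'a rel"
    and M :: "'b measure" and T W :: "'a \<Rightarrow> 'b \<Rightarrow> real"
  assumes "finite P" and "P \<noteq> {}" and "partial_order_on P r"
    and "prob_space M"
    and "prob_space.indep_vars M (\<lambda>_. borel) (case_sum T W) (P <+> P)"
    and "\<And>x. x \<in> P \<Longrightarrow> distr M borel (T x) = uniform_measure lborel {0..1}"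
    and "\<And>x. x \<in> P \<Longrightarrow> distr M borel (W x) = uniform_measure lborel {0..1}"
  shows "\<P>(\<omega> in M. \<exists>x. accepts P r (\<lambda>y. T y \<omega>) (\<lambda>y. W y \<omega>) x \<and> maximal_in P r x) \<ge> 1 / exp 1"
proof -
  interpret prob_space M by fact
  note fin = \<open>finite P\<close> and indep = assms(5)
  let ?K = "P <+> P"
  let ?B = "Pi\<^sub>M P (\<lambda>_. borel :: real measure)"
  define \<mu> where "\<mu> = Pi\<^sub>M P (\<lambda>_. unif)"
  define X where "X \<omega> = (\<lambda>i\<in>?K. case_sum T W i \<omega>)" for \<omega>
  define X1 where "X1 \<omega> = (\<lambda>y\<in>P. T y \<omega>)" for \<omega>
  define X2 where "X2 \<omega> = (\<lambda>y\<in>P. W y \<omega>)" for \<omega>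
  have rv: "random_variable borel (case_sum T W i)" if "i \<in> ?K" for i
    using indep that by (auto simp: indep_vars_def)
  have X: "random_variable (Pi\<^sub>M ?K (\<lambda>_. borel)) X"
    unfolding X_def by (intro measurable_restrict rv)
  have sets_mu: "sets ?B = sets \<mu>" unfolding \<mu>_def by (rule sets_PiM_cong) auto
  have sets_Leb: "sets (Leb P) = sets \<mu>" unfolding \<mu>_def by (rule sets_PiM_cong) auto
  have joint: "distr M (Pi\<^sub>M ?K (\<lambda>_. borel)) X = Pi\<^sub>M ?K (\<lambda>_. unif)"
  proof -
    have "distr M (Pi\<^sub>M ?K (\<lambda>_. borel)) X = Pi\<^sub>M ?K (\<lambda>i. distr M borel (case_sum T W i))"
      using indep rv \<open>P \<noteq> {}\<close> unfolding X_def
      by (subst (asm) indep_vars_iff_distr_eq_PiM') auto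
    also have "\<dots> = Pi\<^sub>M ?K (\<lambda>_. unif)"
      using assms(6,7) by (intro PiM_cong) auto
    finally show ?thesis .
  qed
  have marginal: "distr M ?B (\<lambda>\<omega>. \<lambda>y\<in>P. X \<omega> (f y)) = \<mu>" if f: "inj_on f P" "f \<in> P \<rightarrow> ?K" for f
  proof -
    have m: "(\<lambda>v. \<lambda>y\<in>P. v (f y)) \<in> measurable (Pi\<^sub>M ?K (\<lambda>_. borel)) ?B"
      using f(2) by (intro measurable_restrict measurable_component_singleton) auto
    have "distr M ?B (\<lambda>\<omega>. \<lambda>y\<in>P. X \<omega> (f y)) = distr (Pi\<^sub>M ?K (\<lambda>_. unif)) ?B (\<lambda>v. \<lambda>y\<in>P. v (f y))"
      unfolding joint[symmetric] distr_distr[OF m X] by (simp add: comp_def)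
    also have "\<dots> = distr (Pi\<^sub>M ?K (\<lambda>_. unif)) \<mu> (\<lambda>v. \<lambda>y\<in>P. v (f y))"
      by (rule distr_cong) (auto simp: sets_mu)
    also have "\<dots> = \<mu>" unfolding \<mu>_def
      using f prob_space_uniform_measure[of lborel "{0..1::real}"] by (intro distr_PiM_reindex) auto
    finally show ?thesis .
  qed
  have X1: "X1 = (\<lambda>\<omega>. \<lambda>y\<in>P. X \<omega> (Inl y))" and X2: "X2 = (\<lambda>\<omega>. \<lambda>y\<in>P. X \<omega> (Inr y))"
    by (auto simp: X1_def X2_def X_def fun_eq_iff)
  have d1: "distr M ?B X1 = \<mu>" and d2: "distr M ?B X2 = \<mu>"
    unfolding X1 X2 by (intro marginal; auto)+
  have "indep_var (Pi\<^sub>M (Inl ` P) (\<lambda>_. borel)) (\<lambda>\<omega>. \<lambda>i\<in>Inl ` P. case_sum T W i \<omega>)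
    (Pi\<^sub>M (Inr ` P) (\<lambda>_. borel)) (\<lambda>\<omega>. \<lambda>i\<in>Inr ` P. case_sum T W i \<omega>)"
    by (rule indep_var_restrict[OF indep]) auto
  then have "indep_var ?B ((\<lambda>v. \<lambda>y\<in>P. v (Inl y)) \<circ> (\<lambda>\<omega>. \<lambda>i\<in>Inl ` P. case_sum T W i \<omega>))
    ?B ((\<lambda>v. \<lambda>y\<in>P. v (Inr y)) \<circ> (\<lambda>\<omega>. \<lambda>i\<in>Inr ` P. case_sum T W i \<omega>))"
    by (rule indep_var_compose) (auto intro!: measurable_restrict measurable_component_singleton)
  moreover have "(\<lambda>v. \<lambda>y\<in>P. v (Inl y)) \<circ> (\<lambda>\<omega>. \<lambda>i\<in>Inl ` P. case_sum T W i \<omega>) = X1"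
    "(\<lambda>v. \<lambda>y\<in>P. v (Inr y)) \<circ> (\<lambda>\<omega>. \<lambda>i\<in>Inr ` P. case_sum T W i \<omega>) = X2"
    by (auto simp: X1_def X2_def fun_eq_iff)
  ultimately have "indep_var ?B X1 ?B X2" by simp
  then have law: "distr M (?B \<Otimes>\<^sub>M ?B) (\<lambda>\<omega>. (X1 \<omega>, X2 \<omega>)) = \<mu> \<Otimes>\<^sub>M \<mu>"
    and X12: "(\<lambda>\<omega>. (X1 \<omega>, X2 \<omega>)) \<in> measurable M (?B \<Otimes>\<^sub>M ?B)"
    using indep_var_distribution_eq[of ?B X1 ?B X2] d1 d2 by (auto intro: measurable_Pair)
  let ?A = "{z \<in> space (Leb P \<Otimes>\<^sub>M Leb P). online_success P r (fst z) (snd z)}"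
  have A: "?A \<in> sets (?B \<Otimes>\<^sub>M ?B)"
    using sets_online_success[OF fin, of r] sets_pair_measure_cong[OF sets_Leb sets_Leb]
      sets_pair_measure_cong[OF sets_mu sets_mu] by simp
  have eq: "(\<lambda>\<omega>. (X1 \<omega>, X2 \<omega>)) -` ?A \<inter> space M
    = {\<omega> \<in> space M. \<exists>x. accepts P r (\<lambda>y. T y \<omega>) (\<lambda>y. W y \<omega>) x \<and> maximal_in P r x}"
  proof -
    have "online_success P r (X1 \<omega>) (X2 \<omega>) \<longleftrightarrow> online_success P r (\<lambda>y. T y \<omega>) (\<lambda>y. W y \<omega>)" for \<omega>
      by (rule online_success_cong) (auto simp: X1_def X2_def)
    moreover have "(X1 \<omega>, X2 \<omega>) \<in> space (Leb P \<Otimes>\<^sub>M Leb P)" for \<omega>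
      by (auto simp: X1_def X2_def space_pair_measure space_PiM)
    ultimately show ?thesis by (auto simp: online_success_def)
  qed
  have "ennreal (1 / exp 1) \<le> emeasure (\<mu> \<Otimes>\<^sub>M \<mu>) ?A"
    unfolding \<mu>_def by (rule online_success_probability[OF assms(1-3)])
  also have "\<dots> = emeasure M ((\<lambda>\<omega>. (X1 \<omega>, X2 \<omega>)) -` ?A \<inter> space M)"
    unfolding law[symmetric] by (rule emeasure_distr[OF X12 A])
  finally show ?thesis
    unfolding eq by (simp add: emeasure_eq_measure)
qed

end
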